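(* Let $N,m\ge1$ be integers, $\eta>0$, and let $\mathbf r\in(0,1)^N$ be such that the linear program defining $R^*$ is feasible. Under the LFG algorithm with parameter $\eta$ and input $\mathbf r$, for every finite time horizon $T\ge1$ the time-average regret satisfies $$R_{\mathrm{LFG}}(T)\le\frac{N}{2\eta}+\frac{\beta_1\sqrt{mNT\log T}+\beta_2N}{T},$$ where $\beta_1:=2\sqrt6\,w_{\max}$ and $\beta_2:=\big(1+\frac{5\pi^2}{12}\big)w_{\max}$.
   Context: **Model.** There are $N$ arms, $\mathcal N=\{1,\dots,N\}$, and rounds $t=0,1,2,\dots$. In round $t$ arm $i$ has a random reward $X_i(t)\in[0,1]$ with mean $\mu_i$, and $A(t)\subseteq\mathcal N$ is the random set of available arms, with distribution $P_{\mathbf A}(Z)=P(A(t)=Z)$ for $Z\in\mathcal P(\mathcal N)$ (the power set of $\mathcal N$). Rewards and availability are i.i.d. over time: the pairs $\big(A(t),(X_1(t),\dots,X_N(t))\big)$, $t\ge0$, are i.i.d., and in each round the rewards $(X_1(t),\dots,X_N(t))$ are independent of $A(t)$. The weights $w_i$ are fixed positive numbers with $w_i\le w_{\max}<\infty$. For $Z\subseteq\mathcal N$ let $\mathcal S(Z)=\{S\subseteq Z:|S|\le m\}$ (the feasible super arms). In each round $t$ the player observes $A(t)$, then selects a super arm $S(t)\in\mathcal S(A(t))$, and then observes $X_i(t)$ for $i\in S(t)$. Set $d_i(t)=1$ if $i\in S(t)$ and $d_i(t)=0$ otherwise. **Optimal reward.** $R^*$ is the optimal value of the following linear program in the variables $\mathbf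 q=[q_S(Z):Z\in\mathcal P(\mathcal N),\,S\in\mathcal S(Z)]$: $$\max_{\mathbf q}\ \sum_{Z\in\mathcal P(\mathcal N)}P_{\mathbf A}(Z)\sum_{S\in\mathcal S(Z)}q_S(Z)\sum_{i\in S}w_i\mu_i$$ subject to $\sum_{Z\in\mathcal P(\mathcal N)}P_{\mathbf A}(Z)\sum_{S\in\mathcal S(Z):\,i\in S}q_S(Z)\ge r_i$ for all $i\in\mathcal N$; $\sum_{S\in\mathcal S(Z)}q_S(Z)=1$ for all $Z\in\mathcal P(\mathcal N)$; and $q_S(Z)\in[0,1]$ for all $Z$ and all $S\in\mathcal S(Z)$. Here $r_i$ is the required minimum selection fraction of arm $i$. **Regret.** The time-average regret of a policy $\pi$ choosing $S(t)$ in round $t$ is $$R_\pi(T)=R^*-\mathbb E\Big[\frac1T\sum_{t=0}^{T-1}\sum_{i\in S(t)}w_iX_i(t)\Big].$$ **LFG (Learning with Fairness Guarantee) algorithm**, with parameter $\eta>0$ and input $\mathbf r$. Let $h_i(t)=\sum_{k=0}^t d_i(k)$, $h_i(-1)=0$, and, when $h_i(t)>0$, let $\hat\mu_i(t)=\frac{1}{h_i(t)}\sum_{k=0}^t X_i(k)d_i(k)$. The UCB estimate is $$\bar\mu_i(t)=\min\Big\{\hat\mu_i(t-1)+\sqrt{\tfrac{3\log t}{2h_i(t-1)}},\,1\Big\}\ \text{ if } h_i(t-1)>0,\qquad \bar\mu_i(t)=1\ \text{ if } h_i(t-1)=0.$$ The virtual queue lengths are $Q_i(0)=0$ and $Q_i(t)=\max\{Q_i(t-1)+r_i-d_i(t-1),0\}$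 for $t\ge1$. In each round $t$, after observing $A(t)$, LFG plays a super arm $$S(t)\in\arg\max_{S\in\mathcal S(A(t))}\sum_{i\in S}\big(Q_i(t)+\eta w_i\bar\mu_i(t)\big),$$ with ties broken arbitrarily based only on information available at that time (the past observations and $A(t)$, and possibly independent randomization). Here $\log$ is the natural logarithm. *)

theory Defs
  imports "HOL-Probability.Probability"
begin

definition arms :: "nat \<Rightarrow> nat set" where
  "arms N = {1..N}"

definition super_arms :: "nat \<Rightarrow> nat set \<Rightarrow> nat set set" where
  "super_arms m Z = {S. S \<subseteq> Z \<and> card S \<le> m}"


subsection \<open>The linear program\<close>

text \<open>A variable \<open>q_S(Z)\<close> is written \<open>q Z S\<close>.  Only the values with \<open>Z \<subseteq> arms N\<close> and
  \<open>S \<in> super_arms m Z\<close> are constrained or used; the others are irrelevant.\<close>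

definition lp_feasible ::
  "nat \<Rightarrow> nat \<Rightarrow> (nat set \<Rightarrow> real) \<Rightarrow> (nat \<Rightarrow> real) \<Rightarrow> (nat set \<Rightarrow> nat set \<Rightarrow> real) set" where
  "lp_feasible N m PA r = {q.
     (\<forall>i\<in>arms N. (\<Sum>Z\<in>Pow (arms N). PA Z * (\<Sum>S | S \<in> super_arms m Z \<and> i \<in> S. q Z S)) \<ge> r i) \<and>
     (\<forall>Z\<in>Pow (arms N). (\<Sum>S\<in>super_arms m Z. q Z S) = 1) \<and>
     (\<forall>Z\<in>Pow (arms N). \<forall>S\<in>super_arms m Z. q Z S \<in> {0..1})}"

definition lp_objective ::
  "nat \<Rightarrow> nat \<Rightarrow> (nat set \<Rightarrow> real) \<Rightarrow> (nat \<Rightarrow> real) \<Rightarrow> (nat \<Rightarrow> real) \<Rightarrow>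
    (nat set \<Rightarrow> nat set \<Rightarrow> real) \<Rightarrow> real" where
  "lp_objective N m PA w mu q =
     (\<Sum>Z\<in>Pow (arms N). PA Z * (\<Sum>S\<in>super_arms m Z. q Z S * (\<Sum>i\<in>S. w i * mu i)))"

text \<open>The objective is bounded on the feasible region, so for a feasible program the supremum
  is the optimal value (and it is attained).\<close>

definition optimal_reward ::
  "nat \<Rightarrow> nat \<Rightarrow> (nat set \<Rightarrow> real) \<Rightarrow> (nat \<Rightarrow> real) \<Rightarrow> (nat \<Rightarrow> real) \<Rightarrow> (nat \<Rightarrow> real) \<Rightarrow> real" where
  "optimal_reward N m PA r w mu = (SUP q\<in>lp_feasible N m PA r. lp_objective N m PA w mu q)"


subsection \<open>The stochastic environment\<close>

text \<open>The library's \<^const>\<open>prob_space.indep_var\<close> relates random variables of one common type only; this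
  is the same notion for two types.\<close>

definition (in prob_space) indep_rv ::
  "'b measure \<Rightarrow> ('a \<Rightarrow> 'b) \<Rightarrow> 'c measure \<Rightarrow> ('a \<Rightarrow> 'c) \<Rightarrow> bool" where
  "indep_rv MY Y MZ Z \<longleftrightarrow>
     random_variable MY Y \<and> random_variable MZ Z \<and>
     indep_set (sets (vimage_algebra (space M) Y MY)) (sets (vimage_algebra (space M) Z MZ))"

lemma (in prob_space) indep_rv_iff_indep_var: "indep_rv MY Y MZ Z \<longleftrightarrow> indep_var MY Y MZ Z"
  by (simp add: indep_rv_def indep_var_eq sets_vimage_algebra conj_assoc)

text \<open>\<open>X i t\<close> is the reward of arm \<open>i\<close> in round \<open>t\<close>, and \<open>A t\<close> the set of available arms.\<close>

definition rewards :: "nat \<Rightarrow> (nat \<Rightarrow> nat \<Rightarrow> 'a \<Rightarrow> real) \<Rightarrow> nat \<Rightarrow> 'a \<Rightarrow> (nat \<Rightarrow> real)" where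
  "rewards N X t \<omega> = (\<lambda>i\<in>arms N. X i t \<omega>)"

definition set_space :: "nat \<Rightarrow> nat set measure" where
  "set_space N = count_space (Pow (arms N))"

definition reward_space :: "nat \<Rightarrow> (nat \<Rightarrow> real) measure" where
  "reward_space N = Pi\<^sub>M (arms N) (\<lambda>_. borel)"

locale sleeping_bandit = prob_space M for M :: "'a measure" +
  fixes N :: nat
    and A :: "nat \<Rightarrow> 'a \<Rightarrow> nat set"
    and X :: "nat \<Rightarrow> nat \<Rightarrow> 'a \<Rightarrow> real"
    and PA :: "nat set \<Rightarrow> real"
    and mu :: "nat \<Rightarrow> real"
    and w :: "nat \<Rightarrow> real"
    and wmax :: real
  assumes reward_range: "\<And>i t \<omega>. i \<in> arms N \<Longrightarrow> \<omega> \<in> space M \<Longrightarrow> X i t \<omega> \<in> {0..1}"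
    and rounds_independent:
      "indep_vars (\<lambda>_. set_space N \<Otimes>\<^sub>M reward_space N) (\<lambda>t \<omega>. (A t \<omega>, rewards N X t \<omega>)) UNIV"
    and rounds_identically_distributed:
      "\<And>t. distr M (set_space N \<Otimes>\<^sub>M reward_space N) (\<lambda>\<omega>. (A t \<omega>, rewards N X t \<omega>)) =
           distr M (set_space N \<Otimes>\<^sub>M reward_space N) (\<lambda>\<omega>. (A 0 \<omega>, rewards N X 0 \<omega>))"
    and availability_rewards_independent:
      "\<And>t. indep_rv (set_space N) (A t) (reward_space N) (rewards N X t)"
    and availability_distribution:
      "\<And>t Z. Z \<subseteq> arms N \<Longrightarrow> prob {\<omega>\<in>space M. A t \<omega> = Z} = PA Z"
    and reward_mean: "\<And>i t. i \<in> arms N \<Longrightarrow> expectation (X i t) = mu i"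
    and weights: "\<And>i. i \<in> arms N \<Longrightarrow> 0 < w i \<and> w i \<le> wmax"


subsection \<open>Policies\<close>

text \<open>What the player has learnt by the end of round \<open>k\<close>: the available set, the super arm played
  and the rewards of the arms in it.  The entries of the other arms are masked by \<open>0\<close>; as the super
  arm is recorded too, this is unambiguous.\<close>

definition observation ::
  "nat \<Rightarrow> (nat \<Rightarrow> 'a \<Rightarrow> nat set) \<Rightarrow> (nat \<Rightarrow> nat \<Rightarrow> 'a \<Rightarrow> real) \<Rightarrow> (nat \<Rightarrow> 'a \<Rightarrow> nat set) \<Rightarrow>
    nat \<Rightarrow> 'a \<Rightarrow> nat set \<times> nat set \<times> (nat \<Rightarrow> real)" where
  "observation N A X S k \<omega> =
     (A k \<omega>, S k \<omega>, (\<lambda>i\<in>arms N. if i \<in> S k \<omega> then X i k \<omega> else 0))"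

definition history ::
  "nat \<Rightarrow> (nat \<Rightarrow> 'a \<Rightarrow> nat set) \<Rightarrow> (nat \<Rightarrow> nat \<Rightarrow> 'a \<Rightarrow> real) \<Rightarrow> (nat \<Rightarrow> 'a \<Rightarrow> nat set) \<Rightarrow>
    nat \<Rightarrow> 'a \<Rightarrow> (nat \<Rightarrow> nat set \<times> nat set \<times> (nat \<Rightarrow> real))" where
  "history N A X S t \<omega> = (\<lambda>k\<in>{..<t}. observation N A X S k \<omega>)"

definition history_space ::
  "nat \<Rightarrow> nat \<Rightarrow> (nat \<Rightarrow> nat set \<times> nat set \<times> (nat \<Rightarrow> real)) measure" where
  "history_space N t =
     Pi\<^sub>M {..<t} (\<lambda>_. set_space N \<Otimes>\<^sub>M set_space N \<Otimes>\<^sub>M reward_space N)"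

text \<open>\<open>U\<close> is the player's private randomization, with values in an arbitrary measurable space
  \<open>MU\<close> (a sequence of seeds, one per round, is a special case).  It is independent of the whole
  environment.  \<open>\<phi> t\<close> is the decision rule of round \<open>t\<close>.\<close>

locale bandit_policy = sleeping_bandit M N A X PA mu w wmax
  for M :: "'a measure" and N A X PA mu w wmax +
  fixes m :: nat
    and MU :: "'u measure"
    and U :: "'a \<Rightarrow> 'u"
    and \<phi> :: "nat \<Rightarrow> 'u \<times> (nat \<Rightarrow> nat set \<times> nat set \<times> (nat \<Rightarrow> real)) \<times> nat set \<Rightarrow> nat set"
    and S :: "nat \<Rightarrow> 'a \<Rightarrow> nat set"
  assumes randomization_independent:
      "indep_rv MU U (Pi\<^sub>M UNIV (\<lambda>_. set_space N \<Otimes>\<^sub>M reward_space N))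
         (\<lambda>\<omega> t. (A t \<omega>, rewards N X t \<omega>))"
    and decision_rule_measurable:
      "\<And>t. \<phi> t \<in> measurable (MU \<Otimes>\<^sub>M history_space N t \<Otimes>\<^sub>M set_space N) (set_space N)"
    and non_anticipating:
      "\<And>t \<omega>. \<omega> \<in> space M \<Longrightarrow> S t \<omega> = \<phi> t (U \<omega>, history N A X S t \<omega>, A t \<omega>)"
    and plays_feasible: "\<And>t \<omega>. \<omega> \<in> space M \<Longrightarrow> S t \<omega> \<in> super_arms m (A t \<omega>)"

definition regret ::
  "'a measure \<Rightarrow> nat \<Rightarrow> nat \<Rightarrow> (nat set \<Rightarrow> real) \<Rightarrow> (nat \<Rightarrow> real) \<Rightarrow> (nat \<Rightarrow> real) \<Rightarrow> (nat \<Rightarrow> real) \<Rightarrow>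
    (nat \<Rightarrow> nat \<Rightarrow> 'a \<Rightarrow> real) \<Rightarrow> (nat \<Rightarrow> 'a \<Rightarrow> nat set) \<Rightarrow> nat \<Rightarrow> real" where
  "regret M N m PA r w mu X S T =
     optimal_reward N m PA r w mu -
     prob_space.expectation M (\<lambda>\<omega>. (1 / real T) * (\<Sum>t<T. \<Sum>i\<in>S t \<omega>. w i * X i t \<omega>))"


subsection \<open>Learning with Fairness Guarantee\<close>

text \<open>Below, \<open>s\<close> and \<open>x\<close> are one sample path of the super arms played and of the rewards
  (\<open>x i k\<close> for arm \<open>i\<close> in round \<open>k\<close>).  To avoid the index \<open>-1\<close>, \<open>pulls s i t\<close> and
  \<open>emp_mean s x i t\<close> range over the rounds \<open>k < t\<close>: they are \<open>h_i(t - 1)\<close> and the empirical mean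
  at time \<open>t - 1\<close>.\<close>

definition selected :: "(nat \<Rightarrow> nat set) \<Rightarrow> nat \<Rightarrow> nat \<Rightarrow> nat" where
  "selected s i k = (if i \<in> s k then 1 else 0)"

definition pulls :: "(nat \<Rightarrow> nat set) \<Rightarrow> nat \<Rightarrow> nat \<Rightarrow> nat" where
  "pulls s i t = (\<Sum>k<t. selected s i k)"

definition emp_mean ::
  "(nat \<Rightarrow> nat set) \<Rightarrow> (nat \<Rightarrow> nat \<Rightarrow> real) \<Rightarrow> nat \<Rightarrow> nat \<Rightarrow> real" where
  "emp_mean s x i t = (1 / real (pulls s i t)) * (\<Sum>k<t. x i k * real (selected s i k))"

definition ucb :: "(nat \<Rightarrow> nat set) \<Rightarrow> (nat \<Rightarrow> nat \<Rightarrow> real) \<Rightarrow> nat \<Rightarrow> nat \<Rightarrow> real" where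
  "ucb s x i t =
     (if pulls s i t > 0
      then min (emp_mean s x i t + sqrt (3 * ln (real t) / (2 * real (pulls s i t)))) 1
      else 1)"

primrec queue :: "(nat \<Rightarrow> real) \<Rightarrow> (nat \<Rightarrow> nat set) \<Rightarrow> nat \<Rightarrow> nat \<Rightarrow> real" where
  "queue r s i 0 = 0"
| "queue r s i (Suc t) = max (queue r s i t + r i - real (selected s i t)) 0"

definition lfg_score ::
  "real \<Rightarrow> (nat \<Rightarrow> real) \<Rightarrow> (nat \<Rightarrow> real) \<Rightarrow> (nat \<Rightarrow> nat set) \<Rightarrow> (nat \<Rightarrow> nat \<Rightarrow> real) \<Rightarrow>
    nat \<Rightarrow> nat set \<Rightarrow> real" where
  "lfg_score \<eta> r w s x t B = (\<Sum>i\<in>B. queue r s i t + \<eta> * w i * ucb s x i t)"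

locale lfg = bandit_policy M N A X PA mu w wmax m MU U \<phi> S
  for M :: "'a measure" and N A X PA mu w wmax m and MU :: "'u measure" and U \<phi> S +
  fixes \<eta> :: real
    and r :: "nat \<Rightarrow> real"
  assumes plays_argmax:
    "\<And>t \<omega>. \<omega> \<in> space M \<Longrightarrow>
       is_arg_max (lfg_score \<eta> r w (\<lambda>k. S k \<omega>) (\<lambda>i k. X i k \<omega>) t)
         (\<lambda>B. B \<in> super_arms m (A t \<omega>)) (S t \<omega>)"

end

theory Submission
  imports Defs
begin

text \<open>
  Drift plus penalty: with \<open>L = 1/2 \<Sum>\<^sub>i Q\<^sub>i\<^sup>2\<close>, each round raises \<open>L\<close> by at most
  \<open>N/2 + \<Sum>\<^sub>i Q\<^sub>i (r\<^sub>i - d\<^sub>i)\<close>.  The played super arm scores at least as much as the mixture prescribed by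
  any feasible point \<open>q\<close> of the linear program, whose conditional selection probabilities \<open>c\<^sub>i\<close> satisfy
  \<open>E c\<^sub>i \<ge> r\<^sub>i\<close> independently of the past.  Hence, up to \<open>N/(2\<eta>)\<close> per round, the regret against \<open>q\<close>
  is the expectation of \<open>\<Sum> w\<^sub>i (c\<^sub>i - d\<^sub>i) (\<mu>\<^sub>i - u\<^sub>i)\<close>, where \<open>u\<^sub>i\<close> is the UCB estimate.  Unless the empirical mean
  deviates from \<open>\<mu>\<^sub>i\<close> by more than the confidence radius, which has probability at most \<open>2/t\<^sup>2\<close>, such a term
  is at most \<open>d\<^sub>i\<close> times twice the radius, and these sum up to \<open>2 sqrt (6 m N T ln T)\<close>.
\<close>

subsection \<open>Filtration and independence\<close>

text \<open>The probability of \<open>g \<inter> b \<inter> c\<close> factors in two stages: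
  \<open>g\<close> splits off because \<open>b \<inter> c\<close> lies in \<open>H\<close>, then
  \<open>b\<close> and \<open>c\<close> split. The sets \<open>g \<inter> b\<close> form a pi-system
  generating the join of \<open>G\<close> and \<open>B\<close>, so independence extends to the
  generated sigma-algebras. The lemma serves both for adding the earlier rounds to the private
  randomization and for adding the current availability to the past.\<close>

lemma (in prob_space) indep_set_join:
  assumes GH: "indep_set G H" and BC: "indep_set B C"
    and BCH: "\<And>b c. b \<in> B \<Longrightarrow> c \<in> C \<Longrightarrow> b \<inter> c \<in> H"
    and stable: "Int_stable G" "Int_stable B" "Int_stable C"
    and top: "space M \<in> G" "space M \<in> B" "space M \<in> C"
  shows "indep_set (sigma_sets (space M) (G \<union> B)) (sigma_sets (space M) C)"
proof -
  let ?E = "{g \<inter> b | g b. g \<in> G \<and> b \<in> B}"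
  have ev: "G \<subseteq> events" "B \<subseteq> events" "C \<subseteq> events"
    using indep_setD_ev1[OF GH] indep_setD_ev1[OF BC] indep_setD_ev2[OF BC] by auto
  have indep: "indep_set ?E C"
  proof (rule indep_setI)
    show "?E \<subseteq> events" using ev by blast
    show "C \<subseteq> events" by fact
    fix e c assume "e \<in> ?E" and c: "c \<in> C"
    then obtain g b where e: "e = g \<inter> b" and g: "g \<in> G" and b: "b \<in> B" by blast
    \<comment> \<open>Taking \<open>c = space M\<close> puts \<open>b\<close> itself into
      \<open>H\<close>, which is needed to recombine \<open>prob g * prob b\<close> into
      \<open>prob e\<close>.\<close>
    have "b \<inter> space M = b"
      using b ev sets.sets_into_space by blast
    with BCH[OF b top(3)] have "b \<in> H" by simp
    have "prob (e \<inter> c) = prob (g \<inter> (b \<inter> c))"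
      by (simp add: e Int_assoc)
    also have "\<dots> = prob g * (prob b * prob c)"
      using indep_setD[OF GH g BCH[OF b c]] indep_setD[OF BC b c] by simp
    also have "\<dots> = prob e * prob c"
      using indep_setD[OF GH g \<open>b \<in> H\<close>] by (simp add: e)
    finally show "prob (e \<inter> c) = prob e * prob c" .
  qed
  have "Int_stable ?E"
  proof (rule Int_stableI)
    fix x y assume "x \<in> ?E" "y \<in> ?E"
    then obtain g b g' b' where "x = g \<inter> b" "y = g' \<inter> b'" "g \<in> G" "b \<in> B" "g' \<in> G" "b' \<in> B"
      by blast
    moreover from this have "x \<inter> y = (g \<inter> g') \<inter> (b \<inter> b')" by auto
    moreover from calculation have "g \<inter> g' \<in> G" "b \<inter> b' \<in> B"
      using stable(1,2) by (auto simp: Int_stable_def)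
    ultimately show "x \<inter> y \<in> ?E" by blast
  qed
  from indep_set_sigma_sets[OF indep this stable(3)]
  have *: "indep_set (sigma_sets (space M) ?E) (sigma_sets (space M) C)" .
  have "G \<union> B \<subseteq> sigma_sets (space M) ?E"
  proof
    fix x assume x: "x \<in> G \<union> B"
    then have "x \<subseteq> space M" using ev sets.sets_into_space by blast
    then have "x = x \<inter> space M" "x = space M \<inter> x" by auto
    with x top have "x \<in> ?E" by blast
    then show "x \<in> sigma_sets (space M) ?E" ..
  qed
  then have "sigma_sets (space M) (G \<union> B) \<subseteq> sigma_sets (space M) ?E"
    by (rule sigma_sets_mono)
  with * show ?thesis
    unfolding indep_sets2_eq by blast
qed

text \<open>The algebras generated by \<open>f\<close> and \<open>g\<close> are contained in
  \<open>F\<close> and \<open>G\<close>, so this is the product rule for independent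
  variables.\<close>

lemma (in prob_space) expectation_indep_mult:
  fixes f g :: "'a \<Rightarrow> real"
  assumes indep: "indep_set (sets F) (sets G)" and space: "space F = space M" "space G = space M"
    and f: "f \<in> borel_measurable F" and g: "g \<in> borel_measurable G"
    and int: "integrable M f" "integrable M g"
  shows "integrable M (\<lambda>\<omega>. f \<omega> * g \<omega>)"
    and "expectation (\<lambda>\<omega>. f \<omega> * g \<omega>) = expectation f * expectation g"
proof -
  have "sets (vimage_algebra (space M) f borel) \<subseteq> sets F"
    "sets (vimage_algebra (space M) g borel) \<subseteq> sets G"
    using sets_image_in_sets[OF space(1) f] sets_image_in_sets[OF space(2) g] by auto
  with indep have "indep_set (sets (vimage_algebra (space M) f borel))
      (sets (vimage_algebra (space M) g borel))"
    unfolding indep_sets2_eq by blast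
  then have "indep_var borel f borel g"
    using int by (simp add: indep_var_eq sets_vimage_algebra)
  with int show "integrable M (\<lambda>\<omega>. f \<omega> * g \<omega>)"
    "expectation (\<lambda>\<omega>. f \<omega> * g \<omega>) = expectation f * expectation g"
    by (auto intro: indep_var_integrable indep_var_lebesgue_integral)
qed

section \<open>Sigma-algebras of the environment and of the player's information\<close>

context bandit_policy
begin

definition env :: "nat \<Rightarrow> 'a \<Rightarrow> nat set \<times> (nat \<Rightarrow> real)" where
  "env k \<omega> = (A k \<omega>, rewards N X k \<omega>)"

abbreviation env_space :: "(nat set \<times> (nat \<Rightarrow> real)) measure" where
  "env_space \<equiv> set_space N \<Otimes>\<^sub>M reward_space N"

definition env_algebra :: "nat \<Rightarrow> 'a measure" where
  "env_algebra k = vimage_algebra (space M) (env k) env_space"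

text \<open>\<open>past t\<close> also contains the rewards that the player has not seen; the analysis only needs it to
  be independent of round \<open>t\<close>.\<close>

definition past :: "nat \<Rightarrow> 'a measure" where
  "past t = sigma (space M)
     (sets (vimage_algebra (space M) U MU) \<union> (\<Union>k<t. sets (env_algebra k)))"

text \<open>The stage between two rounds at which \<open>S t\<close> is chosen: the current
  availability is already included, the current rewards are not.\<close>

definition info :: "nat \<Rightarrow> 'a measure" where
  "info t = sigma (space M)
     (sets (past t) \<union> sets (vimage_algebra (space M) (A t) (set_space N)))"

lemma env_measurable [measurable]: "env k \<in> M \<rightarrow>\<^sub>M env_space"
  using rounds_independent unfolding indep_vars_def env_def by auto

lemma A_measurable [measurable]: "A k \<in> M \<rightarrow>\<^sub>M set_space N"
  and rewards_measurable [measurable]: "rewards N X k \<in> M \<rightarrow>\<^sub>M reward_space N"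
  using availability_rewards_independent unfolding indep_rv_def by auto

lemma U_measurable [measurable]: "U \<in> M \<rightarrow>\<^sub>M MU"
  using randomization_independent unfolding indep_rv_def by auto

lemma A_subset: "\<omega> \<in> space M \<Longrightarrow> A k \<omega> \<subseteq> arms N"
  using measurable_space[OF A_measurable, of \<omega> k] by (simp add: set_space_def)

lemma S_subset: "\<omega> \<in> space M \<Longrightarrow> S k \<omega> \<subseteq> A k \<omega>"
  and card_S: "\<omega> \<in> space M \<Longrightarrow> card (S k \<omega>) \<le> m"
  using plays_feasible[of \<omega> k] by (auto simp: super_arms_def)

lemma space_env_algebra [simp]: "space (env_algebra k) = space M"
  and space_past [simp]: "space (past t) = space M"
  and space_info [simp]: "space (info t) = space M"
  by (simp_all add: env_algebra_def past_def info_def space_measure_of_conv)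

lemma env_algebra_le: "sets (env_algebra k) \<subseteq> events"
  unfolding env_algebra_def by (rule sets_image_in_sets) auto

lemma sets_past: "sets (past t) =
    sigma_sets (space M) (sets (vimage_algebra (space M) U MU) \<union> (\<Union>k<t. sets (env_algebra k)))"
proof -
  have "sets (vimage_algebra (space M) U MU) \<subseteq> Pow (space M)"
    using sets.space_closed[of "vimage_algebra (space M) U MU"] by simp
  moreover have "sets (env_algebra k) \<subseteq> Pow (space M)" for k
    using env_algebra_le sets.space_closed by blast
  ultimately show ?thesis
    unfolding past_def by (intro sets_measure_of) blast
qed

lemma sets_info: "sets (info t) = sigma_sets (space M)
    (sets (past t) \<union> sets (vimage_algebra (space M) (A t) (set_space N)))"
proof -
  have "sets (vimage_algebra (space M) (A t) (set_space N)) \<subseteq> Pow (space M)"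
    using sets.space_closed[of "vimage_algebra (space M) (A t) (set_space N)"] by simp
  moreover have "sets (past t) \<subseteq> Pow (space M)"
    using sets.space_closed[of "past t"] by simp
  ultimately show ?thesis
    unfolding info_def by (intro sets_measure_of) blast
qed

lemma env_algebra_past: "k < t \<Longrightarrow> sets (env_algebra k) \<subseteq> sets (past t)"
  unfolding sets_past by (auto intro: sigma_sets.Basic)

lemma past_mono: "s \<le> t \<Longrightarrow> sets (past s) \<subseteq> sets (past t)"
  unfolding sets_past by (intro sigma_sets_mono') auto

lemma past_le_info: "sets (past t) \<subseteq> sets (info t)"
  unfolding sets_info by (auto intro: sigma_sets.Basic)

lemma env_env_algebra: "env k \<in> env_algebra k \<rightarrow>\<^sub>M env_space"
  unfolding env_algebra_def
  by (rule measurable_vimage_algebra1) (use measurable_space[OF env_measurable] in auto)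

lemma A_env_algebra: "A k \<in> env_algebra k \<rightarrow>\<^sub>M set_space N"
  and rewards_env_algebra: "rewards N X k \<in> env_algebra k \<rightarrow>\<^sub>M reward_space N"
  using measurable_compose[OF env_env_algebra measurable_fst, of k]
    measurable_compose[OF env_env_algebra measurable_snd, of k]
  by (simp_all add: env_def)

lemma info_le_past_Suc: "sets (info t) \<subseteq> sets (past (Suc t))"
proof -
  have "sets (vimage_algebra (space M) (A t) (set_space N)) \<subseteq> sets (env_algebra t)"
    by (rule sets_image_in_sets) (auto intro: A_env_algebra)
  then have "sets (past t) \<union> sets (vimage_algebra (space M) (A t) (set_space N)) \<subseteq> sets (past (Suc t))"
    using past_mono[of t "Suc t"] env_algebra_past[of t "Suc t"] by auto
  then show ?thesis
    unfolding sets_info using sets.sigma_sets_subset[of _ "past (Suc t)"] by simp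
qed

lemma past_le_events: "sets (past t) \<subseteq> events"
proof -
  have "sets (vimage_algebra (space M) U MU) \<subseteq> events"
    by (rule sets_image_in_sets) auto
  then have "sets (vimage_algebra (space M) U MU) \<union> (\<Union>k<t. sets (env_algebra k)) \<subseteq> events"
    using env_algebra_le by blast
  then show ?thesis
    unfolding sets_past by (rule sets.sigma_sets_subset)
qed

lemma info_le_events: "sets (info t) \<subseteq> events"
  using info_le_past_Suc past_le_events by blast

lemma measurable_past_mono: "f \<in> past s \<rightarrow>\<^sub>M L \<Longrightarrow> s \<le> t \<Longrightarrow> f \<in> past t \<rightarrow>\<^sub>M L"
  using measurable_mono[of L L "past s" "past t"] past_mono[of s t] by auto

lemma measurable_past_info: "f \<in> past t \<rightarrow>\<^sub>M L \<Longrightarrow> f \<in> info t \<rightarrow>\<^sub>M L"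
  using measurable_mono[of L L "past t" "info t"] past_le_info[of t] by auto

lemma measurable_info_past: "f \<in> info s \<rightarrow>\<^sub>M L \<Longrightarrow> s < t \<Longrightarrow> f \<in> past t \<rightarrow>\<^sub>M L"
  using measurable_mono[of L L "info s" "past t"] info_le_past_Suc[of s] past_mono[of "Suc s" t]
  by auto

lemma measurable_info_M: "f \<in> info t \<rightarrow>\<^sub>M L \<Longrightarrow> f \<in> M \<rightarrow>\<^sub>M L"
  using measurable_mono[of L L "info t" M] info_le_events[of t] by auto

lemma measurable_env_past: "f \<in> env_algebra k \<rightarrow>\<^sub>M L \<Longrightarrow> k < t \<Longrightarrow> f \<in> past t \<rightarrow>\<^sub>M L"
  using measurable_mono[of L L "env_algebra k" "past t"] env_algebra_past[of k t] by auto

lemma U_past: "U \<in> past t \<rightarrow>\<^sub>M MU"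
proof -
  have "sets (vimage_algebra (space M) U MU) \<subseteq> sets (past t)"
    unfolding sets_past by (auto intro: sigma_sets.Basic)
  moreover have "U \<in> vimage_algebra (space M) U MU \<rightarrow>\<^sub>M MU"
    by (rule measurable_vimage_algebra1) (use measurable_space[OF U_measurable] in auto)
  ultimately show ?thesis
    using measurable_mono[of MU MU "vimage_algebra (space M) U MU" "past t"] by auto
qed

lemma A_info: "A t \<in> info t \<rightarrow>\<^sub>M set_space N"
proof -
  have "sets (vimage_algebra (space M) (A t) (set_space N)) \<subseteq> sets (info t)"
    unfolding sets_info by (auto intro: sigma_sets.Basic)
  moreover have "A t \<in> vimage_algebra (space M) (A t) (set_space N) \<rightarrow>\<^sub>M set_space N"
    by (rule measurable_vimage_algebra1) (use measurable_space[OF A_measurable] in auto)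
  ultimately show ?thesis
    using measurable_mono[of "set_space N" "set_space N" "vimage_algebra (space M) (A t) (set_space N)" "info t"]
    by auto
qed

lemma X_rewards_algebra:
  assumes "i \<in> arms N"
  shows "X i k \<in> borel_measurable (vimage_algebra (space M) (rewards N X k) (reward_space N))"
proof -
  have "rewards N X k \<in> vimage_algebra (space M) (rewards N X k) (reward_space N) \<rightarrow>\<^sub>M reward_space N"
    by (rule measurable_vimage_algebra1) (use measurable_space[OF rewards_measurable] in auto)
  moreover have "(\<lambda>x. x i) \<in> reward_space N \<rightarrow>\<^sub>M borel"
    unfolding reward_space_def using assms by simp
  ultimately have "(\<lambda>\<omega>. rewards N X k \<omega> i) \<in> borel_measurable (vimage_algebra (space M) (rewards N X k) (reward_space N))"
    by (rule measurable_compose)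
  then show ?thesis
    using assms by (simp add: rewards_def)
qed

lemma rewards_algebra_le_env:
  "sets (vimage_algebra (space M) (rewards N X k) (reward_space N)) \<subseteq> sets (env_algebra k)"
  by (rule sets_image_in_sets) (auto intro: rewards_env_algebra)

lemma X_past: "i \<in> arms N \<Longrightarrow> k < t \<Longrightarrow> X i k \<in> borel_measurable (past t)"
  using measurable_mono[of borel borel "vimage_algebra (space M) (rewards N X k) (reward_space N)" "past t"]
    X_rewards_algebra rewards_algebra_le_env env_algebra_past by (auto simp: subset_iff)

lemma X_measurable [measurable]: "i \<in> arms N \<Longrightarrow> X i k \<in> borel_measurable M"
  using X_past[of i k "Suc k"] measurable_past_info measurable_info_M by blast

lemma in_S_measurable:
  assumes "S t \<in> F \<rightarrow>\<^sub>M set_space N" "space F = space M"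
  shows "{\<omega> \<in> space M. i \<in> S t \<omega>} \<in> sets F"
proof -
  have "{B. i \<in> B} \<inter> Pow (arms N) \<in> sets (set_space N)"
    by (simp add: set_space_def)
  from measurable_sets[OF assms(1) this]
  have "S t -` ({B. i \<in> B} \<inter> Pow (arms N)) \<inter> space F \<in> sets F" .
  also have "S t -` ({B. i \<in> B} \<inter> Pow (arms N)) \<inter> space F = {\<omega> \<in> space M. i \<in> S t \<omega>}"
    using S_subset A_subset assms(2) by fastforce
  finally show ?thesis .
qed

text \<open>Strong induction on the round: the history consists of availabilities, super arms and
  masked rewards of earlier rounds, all measurable in \<open>past t\<close>, and the decision rule
  is composed with it, the seed \<open>U\<close> and \<open>A t\<close>.\<close>

lemma S_info: "S t \<in> info t \<rightarrow>\<^sub>M set_space N"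
proof (induction t rule: less_induct)
  case (less t)
  have S_past: "S k \<in> past t \<rightarrow>\<^sub>M set_space N" if "k < t" for k
    using less[OF that] that by (rule measurable_info_past)
  have "(\<lambda>\<omega>. observation N A X S k \<omega>)
      \<in> past t \<rightarrow>\<^sub>M set_space N \<Otimes>\<^sub>M set_space N \<Otimes>\<^sub>M reward_space N" if k: "k < t" for k
  proof -
    have [measurable]: "S k \<in> past t \<rightarrow>\<^sub>M set_space N"
      by (rule S_past[OF k])
    have [measurable]: "A k \<in> past t \<rightarrow>\<^sub>M set_space N"
      using A_env_algebra k by (rule measurable_env_past)
    have [measurable]: "X i k \<in> borel_measurable (past t)" if "i \<in> arms N" for i
      using that k by (rule X_past)
    have P: "{\<omega> \<in> space (past t). i \<in> S k \<omega>} \<in> sets (past t)" for i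
      using in_S_measurable[OF S_past[OF k]] by simp
    have "(\<lambda>\<omega>. \<lambda>i\<in>arms N. if i \<in> S k \<omega> then X i k \<omega> else 0) \<in> past t \<rightarrow>\<^sub>M reward_space N"
      unfolding reward_space_def
      by (rule measurable_restrict) (intro measurable_If P; simp)
    then show ?thesis
      unfolding observation_def by measurable
  qed
  then have "history N A X S t \<in> past t \<rightarrow>\<^sub>M history_space N t"
    unfolding history_def[abs_def] history_space_def by (intro measurable_restrict) simp
  note this[THEN measurable_past_info, measurable] A_info[of t, measurable]
    U_past[of t, THEN measurable_past_info, measurable]
  have "(\<lambda>\<omega>. \<phi> t (U \<omega>, history N A X S t \<omega>, A t \<omega>)) \<in> info t \<rightarrow>\<^sub>M set_space N"
    using decision_rule_measurable by (rule measurable_compose[rotated]) measurable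
  then show ?case
    by (subst measurable_cong[OF non_anticipating]) auto
qed

text \<open>The seed is independent of the whole environment sequence, and the earlier rounds are
  independent of round \<open>t\<close>; \<open>indep_set_join\<close> merges the two facts.\<close>

lemma indep_past_env: "indep_set (sets (past t)) (sets (env_algebra t))"
proof -
  let ?U = "sets (vimage_algebra (space M) U MU)"
  let ?B = "sigma_sets (space M) (\<Union>k<t. sets (env_algebra k))"
  let ?E = "vimage_algebra (space M) (\<lambda>\<omega> k. env k \<omega>) (Pi\<^sub>M UNIV (\<lambda>_. env_space))"
  have "indep_set ?U (sets ?E)"
    using randomization_independent by (simp add: indep_rv_def env_def)
  moreover have "indep_set ?B (sets (env_algebra t))"
  proof -
    \<comment> \<open>The rounds are grouped into two disjoint blocks, the earlier ones and round
      \<open>t\<close> alone.\<close>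
    let ?J = "case_bool {..<t} {t}"
    have env_sets: "sets (env_algebra k) = {env k -` B \<inter> space M |B. B \<in> sets env_space}" for k
      unfolding env_algebra_def
      by (rule sets_vimage_algebra2) (use measurable_space[OF env_measurable] in auto)
    have "indep_sets (\<lambda>k. sets (env_algebra k)) UNIV"
      using rounds_independent unfolding indep_vars_def2 env_sets env_def by simp
    then have "indep_sets (\<lambda>k. sets (env_algebra k)) (\<Union>j\<in>UNIV. ?J j)"
      by (rule indep_sets_mono_index[rotated]) simp
    then have "indep_sets (\<lambda>j. sigma_sets (space M) (\<Union>k\<in>?J j. sets (env_algebra k))) UNIV"
      by (rule indep_sets_collect_sigma)
        (auto simp: disjoint_family_on_def sets.Int_stable split: bool.split)
    then have "indep_set (sigma_sets (space M) (\<Union>k\<in>?J True. sets (env_algebra k)))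
        (sigma_sets (space M) (\<Union>k\<in>?J False. sets (env_algebra k)))"
      unfolding indep_set_def
      by (rule indep_sets_mono_sets) (auto split: bool.split)
    then show ?thesis
      using sets.sigma_sets_eq[of "env_algebra t"] by simp
  qed
  \<comment> \<open>Both blocks are functions of the environment sequence, so their intersections
    belong to its sigma-algebra, from which \<open>U\<close> is independent.\<close>
  moreover have "b \<inter> c \<in> sets ?E" if "b \<in> ?B" "c \<in> sets (env_algebra t)" for b c
  proof -
    have "(\<lambda>\<omega> k. env k \<omega>) \<in> ?E \<rightarrow>\<^sub>M Pi\<^sub>M UNIV (\<lambda>_. env_space)"
      by (rule measurable_vimage_algebra1)
        (use measurable_space[OF env_measurable] in \<open>auto simp: space_PiM PiE_iff\<close>)
    then have "(\<lambda>\<omega>. env k \<omega>) \<in> ?E \<rightarrow>\<^sub>M env_space" for k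
      by (rule measurable_compose) simp
    then have E: "sets (env_algebra k) \<subseteq> sets ?E" for k
      unfolding env_algebra_def by (intro sets_image_in_sets) auto
    then have "(\<Union>k<t. sets (env_algebra k)) \<subseteq> sets ?E" by blast
    then have "?B \<subseteq> sets ?E"
      using sets.sigma_sets_subset[of _ ?E] by simp
    with E that show ?thesis by blast
  qed
  moreover have "Int_stable ?B"
  proof -
    have "(\<Union>k<t. sets (env_algebra k)) \<subseteq> Pow (space M)"
      using env_algebra_le sets.space_closed by blast
    then interpret B: sigma_algebra "space M" ?B
      by (rule sigma_algebra_sigma_sets)
    show ?thesis by (auto simp: Int_stable_def)
  qed
  moreover have "space M \<in> ?U" "space M \<in> sets (env_algebra t)"
    using sets.top[of "vimage_algebra (space M) U MU"] sets.top[of "env_algebra t"] by simp_all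
  ultimately have "indep_set (sigma_sets (space M) (?U \<union> ?B)) (sigma_sets (space M) (sets (env_algebra t)))"
    by (intro indep_set_join) (auto simp: sets.Int_stable sigma_sets_top)
  then have *: "indep_set (sigma_sets (space M) (?U \<union> ?B)) (sets (env_algebra t))"
    using sets.sigma_sets_eq[of "env_algebra t"] by simp
  have "sets (past t) \<subseteq> sigma_sets (space M) (?U \<union> ?B)"
    unfolding sets_past by (rule sigma_sets_mono') auto
  with * show ?thesis
    unfolding indep_sets2_eq by blast
qed

text \<open>Within round \<open>t\<close> availability and rewards are independent, and together
  they are independent of the past; hence revealing \<open>A t\<close> does not bias the
  rewards.\<close>

lemma indep_info_rewards:
  "indep_set (sets (info t)) (sets (vimage_algebra (space M) (rewards N X t) (reward_space N)))"
proof -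
  let ?A = "sets (vimage_algebra (space M) (A t) (set_space N))"
  let ?R = "sets (vimage_algebra (space M) (rewards N X t) (reward_space N))"
  have "?A \<subseteq> sets (env_algebra t)"
    by (rule sets_image_in_sets) (auto intro: A_env_algebra)
  then have "indep_set (sigma_sets (space M) (sets (past t) \<union> ?A)) (sigma_sets (space M) ?R)"
    using indep_past_env availability_rewards_independent[of t] rewards_algebra_le_env[of t]
      sets.top[of "past t"] sets.top[of "vimage_algebra (space M) (A t) (set_space N)"]
      sets.top[of "vimage_algebra (space M) (rewards N X t) (reward_space N)"]
    by (intro indep_set_join) (auto simp: indep_rv_def sets.Int_stable)
  then show ?thesis
    unfolding sets_info
    using sets.sigma_sets_eq[of "vimage_algebra (space M) (rewards N X t) (reward_space N)"] by simp
qed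

end

subsection \<open>Sample path inequalities\<close>

lemma finite_arms [simp]: "finite (arms N)"
  and card_arms [simp]: "card (arms N) = N"
  by (simp_all add: arms_def)

section \<open>Counting the plays of an arm\<close>

lemma pulls_0 [simp]: "pulls s i 0 = 0"
  and pulls_Suc: "pulls s i (Suc t) = pulls s i t + selected s i t"
  by (simp_all add: pulls_def)

lemma pulls_le: "pulls s i t \<le> t"
  by (induction t) (auto simp: pulls_Suc selected_def)

text \<open>Only the first play of an arm finds its counter at zero. Such rounds have no confidence
  radius and are charged separately.\<close>

lemma sum_first_pull_le:
  "(\<Sum>k<t. if i \<in> s k \<and> pulls s i k = 0 then 1 else 0) \<le> (1::real)"
proof -
  have "(\<Sum>k<t. if i \<in> s k \<and> pulls s i k = 0 then 1 else 0) = (if pulls s i t = 0 then 0 else 1::real)"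
    by (induction t) (auto simp: pulls_Suc selected_def)
  then show ?thesis by simp
qed

text \<open>Successive plays meet the counters 0, 1, 2, and so on, so with \<open>n\<close> plays
  this is the sum of \<open>1 / sqrt j\<close> for \<open>j\<close> from 1 to \<open>n - 1\<close>.
  The counter 0 is left out, and truncated subtraction gives 0 for an arm never played.\<close>

lemma sum_inverse_sqrt_pulls_le:
  "(\<Sum>k<t. if i \<in> s k \<and> pulls s i k > 0 then 1 / sqrt (pulls s i k) else 0)
    \<le> 2 * sqrt (real (pulls s i t - 1))"
proof (induction t)
  case (Suc t)
  show ?case
  proof (cases "i \<in> s t \<and> pulls s i t > 0")
    case True
    define h where "h = real (pulls s i t)"
    have h: "h \<ge> 1" using True by (simp add: h_def)
    \<comment> \<open>The mean inequality for \<open>h - 1\<close> and \<open>h\<close> gives the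
      increment bound \<open>2 * sqrt (h - 1) + 1 / sqrt h \<le> 2 * sqrt h\<close>.\<close>
    have "sqrt (h - 1) * sqrt h \<le> (h - 1 + h) / 2"
      using arith_geo_mean_sqrt[of "h - 1" h] h by (simp add: real_sqrt_mult)
    then have "2 * sqrt (h - 1) * sqrt h + 1 \<le> 2 * (sqrt h * sqrt h)"
      using h by simp
    then have "(2 * sqrt (h - 1) * sqrt h + 1) / sqrt h \<le> 2 * (sqrt h * sqrt h) / sqrt h"
      using h by (intro divide_right_mono) auto
    also have "2 * (sqrt h * sqrt h) / sqrt h = 2 * sqrt h"
      using h by (simp del: real_sqrt_mult_self)
    finally have "2 * sqrt (h - 1) + 1 / sqrt h \<le> 2 * sqrt h"
      using h by (simp add: add_divide_distrib)
    moreover have "real (pulls s i t - 1) = h - 1" "pulls s i (Suc t) - 1 = pulls s i t"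
      using True by (auto simp: h_def pulls_Suc selected_def)
    ultimately show ?thesis
      using Suc True by (simp add: h_def)
  next
    case False
    then have "pulls s i (Suc t) - 1 = pulls s i t - 1 \<or> pulls s i t = 0"
      by (auto simp: pulls_Suc selected_def)
    then show ?thesis
      using Suc False by (auto intro: order_trans)
  qed
qed simp

lemma sum_pulls_le:
  assumes "\<And>k. s k \<subseteq> arms N" "\<And>k. card (s k) \<le> m"
  shows "(\<Sum>i\<in>arms N. pulls s i t) \<le> m * t"
proof -
  have "(\<Sum>i\<in>arms N. selected s i k) = card (s k)" for k
    using assms(1)[of k] by (simp add: selected_def sum.If_cases Int_absorb1)
  then have "(\<Sum>i\<in>arms N. pulls s i t) = (\<Sum>k<t. card (s k))"
    unfolding pulls_def by (subst sum.swap) simp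
  also have "\<dots> \<le> (\<Sum>k<t. m)"
    by (intro sum_mono assms)
  finally show ?thesis by (simp add: mult.commute)
qed

text \<open>Cauchy-Schwarz against the constant 1, with at most \<open>m\<close> plays in each
  round.\<close>

lemma sum_sqrt_pulls_le:
  assumes "\<And>k. s k \<subseteq> arms N" "\<And>k. card (s k) \<le> m"
  shows "(\<Sum>i\<in>arms N. sqrt (pulls s i t)) \<le> sqrt (real m * real N * real t)"
proof (rule real_le_rsqrt)
  have "(\<Sum>i\<in>arms N. 1 * sqrt (pulls s i t))\<^sup>2
      \<le> (\<Sum>i\<in>arms N. 1\<^sup>2) * (\<Sum>i\<in>arms N. (sqrt (pulls s i t))\<^sup>2)"
    by (rule Cauchy_Schwarz_ineq_sum)
  also have "\<dots> = real N * real (\<Sum>i\<in>arms N. pulls s i t)"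
    by simp
  also have "\<dots> \<le> real N * real (m * t)"
    using sum_pulls_le[OF assms] by (intro mult_left_mono of_nat_mono) auto
  finally show "(\<Sum>i\<in>arms N. sqrt (pulls s i t))\<^sup>2 \<le> real m * real N * real t"
    by (simp add: algebra_simps)
qed

section \<open>Confidence bounds and the cost of estimation\<close>

definition radius :: "(nat \<Rightarrow> nat set) \<Rightarrow> nat \<Rightarrow> nat \<Rightarrow> real" where
  "radius s i t = sqrt (3 * ln (real t) / (2 * real (pulls s i t)))"

definition deviates ::
  "(nat \<Rightarrow> nat set) \<Rightarrow> (nat \<Rightarrow> nat \<Rightarrow> real) \<Rightarrow> real \<Rightarrow> nat \<Rightarrow> nat \<Rightarrow> bool" where
  "deviates s x \<mu> i t \<longleftrightarrow> pulls s i t > 0 \<and> \<bar>emp_mean s x i t - \<mu>\<bar> > radius s i t"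

lemma radius_nonneg: "radius s i t \<ge> 0"
  unfolding radius_def by (cases "t = 0") (auto intro!: real_sqrt_ge_zero divide_nonneg_nonneg)

lemma ucb_range:
  assumes "\<And>k. x i k \<in> {0..1}"
  shows "ucb s x i t \<in> {0..1}"
proof -
  have "emp_mean s x i t \<ge> 0"
    unfolding emp_mean_def using assms by (intro mult_nonneg_nonneg sum_nonneg) auto
  with radius_nonneg[of s i t] show ?thesis
    by (auto simp: ucb_def radius_def)
qed

text \<open>On a deviation both factors have absolute value at most 1. Otherwise the estimate is
  optimistic, so the part with \<open>c\<close> can only help, and a cost arises only if the arm is
  played: at most 1 on its first play, at most twice the radius later.\<close>

lemma ucb_regret_le:
  fixes c \<mu> :: real
  assumes x: "\<And>k. x i k \<in> {0..1}" and \<mu>: "\<mu> \<in> {0..1}" and c: "c \<in> {0..1}"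
  shows "(c - real (selected s i t)) * (\<mu> - ucb s x i t)
    \<le> of_bool (deviates s x \<mu> i t)
      + (if i \<in> s t \<and> pulls s i t = 0 then 1 else 0)
      + (if i \<in> s t \<and> pulls s i t > 0 then 2 * radius s i t else 0)"
proof -
  define d where "d = real (selected s i t)"
  define u where "u = ucb s x i t"
  have d: "d = (if i \<in> s t then 1 else 0)" by (simp add: d_def selected_def)
  have u: "u \<in> {0..1}" unfolding u_def using x by (rule ucb_range)
  note rad = radius_nonneg[of s i t]
  have *: "(c - d) * (\<mu> - u) \<le> of_bool (deviates s x \<mu> i t)
      + (if i \<in> s t \<and> pulls s i t = 0 then 1 else 0)
      + (if i \<in> s t \<and> pulls s i t > 0 then 2 * radius s i t else 0)"
  proof (cases "deviates s x \<mu> i t")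
    case True
    have "(c - d) * (\<mu> - u) \<le> \<bar>c - d\<bar> * \<bar>\<mu> - u\<bar>"
      by (metis abs_ge_self abs_mult)
    also have "\<dots> \<le> 1 * 1"
      using c d \<mu> u by (intro mult_mono) auto
    finally show ?thesis using True rad by auto
  next
    case False
    \<comment> \<open>Capping at 1 preserves optimism because the mean is at most 1; for an arm not
      yet played the estimate is 1 itself.\<close>
    have "u \<ge> \<mu> \<and> (pulls s i t > 0 \<longrightarrow> u - \<mu> \<le> 2 * radius s i t)"
      using False \<mu> by (auto simp: u_def ucb_def deviates_def radius_def[symmetric])
    then have u\<mu>: "u \<ge> \<mu>" "pulls s i t > 0 \<Longrightarrow> u - \<mu> \<le> 2 * radius s i t" by auto
    have "(c - d) * (\<mu> - u) = d * (u - \<mu>) - c * (u - \<mu>)" by (simp add: algebra_simps)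
    also have "\<dots> \<le> d * (u - \<mu>)" using c u\<mu> by simp
    finally show ?thesis
      using d u\<mu> \<mu> u False by auto
  qed
  then show ?thesis by (simp add: d_def u_def)
qed

lemma radius_le:
  assumes "k < t"
  shows "(if i \<in> s k \<and> pulls s i k > 0 then 2 * radius s i k else 0)
    \<le> sqrt (6 * ln (real t)) * (if i \<in> s k \<and> pulls s i k > 0 then 1 / sqrt (pulls s i k) else 0)"
proof (cases "i \<in> s k \<and> pulls s i k > 0")
  case True
  \<comment> \<open>No arm has been pulled before round 0; a positive \<open>k\<close> makes the
    logarithm monotone from \<open>k\<close> to \<open>t\<close>.\<close>
  then have "k > 0" by (cases k) auto
  have "2 * radius s i k = sqrt (4 * (3 * ln (real k) / (2 * real (pulls s i k))))"
    by (simp only: radius_def real_sqrt_mult real_sqrt_four)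
  also have "4 * (3 * ln (real k) / (2 * real (pulls s i k))) = 6 * ln (real k) / real (pulls s i k)"
    by simp
  also have "sqrt \<dots> \<le> sqrt (6 * ln (real t) / real (pulls s i k))"
    using \<open>k > 0\<close> assms by (intro real_sqrt_le_mono divide_right_mono) auto
  finally show ?thesis using True by (simp add: real_sqrt_divide)
qed auto

text \<open>The three terms of \<open>ucb_regret_le\<close> are summed: the deviations are kept for
  the expectation, the first plays contribute at most 1 per arm, and the radii are collected by arm
  and then bounded by Cauchy-Schwarz.\<close>

lemma sum_ucb_regret_le:
  fixes c :: "nat \<Rightarrow> nat \<Rightarrow> real"
  assumes x: "\<And>i k. i \<in> arms N \<Longrightarrow> x i k \<in> {0..1}" and \<mu>: "\<And>i. i \<in> arms N \<Longrightarrow> \<mu> i \<in> {0..1}"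
    and c: "\<And>i k. i \<in> arms N \<Longrightarrow> c i k \<in> {0..1}"
    and w: "\<And>i. i \<in> arms N \<Longrightarrow> 0 < w i \<and> w i \<le> wmax" and "wmax \<ge> 0"
    and s: "\<And>k. s k \<subseteq> arms N" "\<And>k. card (s k) \<le> m"
  shows "(\<Sum>k<t. \<Sum>i\<in>arms N. w i * ((c i k - real (selected s i k)) * (\<mu> i - ucb s x i k)))
    \<le> wmax * ((\<Sum>k<t. \<Sum>i\<in>arms N. of_bool (deviates s x (\<mu> i) i k)) + real N
        + 2 * sqrt (6 * ln (real t)) * sqrt (real m * real N * real t))"
proof -
  let ?a = "\<lambda>i k. of_bool (deviates s x (\<mu> i) i k) :: real"
  let ?b = "\<lambda>i k. if i \<in> s k \<and> pulls s i k = 0 then 1 else 0 :: real"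
  let ?e = "\<lambda>i k. if i \<in> s k \<and> pulls s i k > 0 then 1 / sqrt (pulls s i k) else 0"
  let ?L = "sqrt (6 * ln (real t))"
  \<comment> \<open>The case \<open>t = 0\<close> relies on the convention that \<open>ln 0\<close>
    is 0.\<close>
  have L: "?L \<ge> 0" by (cases "t = 0") auto
  have "(\<Sum>k<t. \<Sum>i\<in>arms N. w i * ((c i k - real (selected s i k)) * (\<mu> i - ucb s x i k)))
      \<le> (\<Sum>k<t. \<Sum>i\<in>arms N. wmax * (?a i k + ?b i k + ?L * ?e i k))"
  proof (intro sum_mono)
    fix k i assume k: "k \<in> {..<t}" and i: "i \<in> arms N"
    have "(c i k - real (selected s i k)) * (\<mu> i - ucb s x i k)
        \<le> ?a i k + ?b i k + (if i \<in> s k \<and> pulls s i k > 0 then 2 * radius s i k else 0)"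
      using x[OF i] \<mu>[OF i] c[OF i] by (rule ucb_regret_le)
    also have "\<dots> \<le> ?a i k + ?b i k + ?L * ?e i k"
      using k by (intro add_left_mono radius_le) simp
    finally have "w i * ((c i k - real (selected s i k)) * (\<mu> i - ucb s x i k))
        \<le> w i * (?a i k + ?b i k + ?L * ?e i k)"
      using w[OF i] by (intro mult_left_mono) auto
    also have "\<dots> \<le> wmax * (?a i k + ?b i k + ?L * ?e i k)"
      using w[OF i] L by (intro mult_right_mono add_nonneg_nonneg mult_nonneg_nonneg) auto
    finally show "w i * ((c i k - real (selected s i k)) * (\<mu> i - ucb s x i k))
        \<le> wmax * (?a i k + ?b i k + ?L * ?e i k)" .
  qed
  also have "\<dots> = wmax * ((\<Sum>k<t. \<Sum>i\<in>arms N. ?a i k) + (\<Sum>i\<in>arms N. \<Sum>k<t. ?b i k)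
      + ?L * (\<Sum>i\<in>arms N. \<Sum>k<t. ?e i k))"
    by (subst (2 3) sum.swap) (simp only: sum_distrib_left sum.distrib distrib_left)
  also have "\<dots> \<le> wmax * ((\<Sum>k<t. \<Sum>i\<in>arms N. ?a i k) + (\<Sum>i\<in>arms N. 1)
      + ?L * (\<Sum>i\<in>arms N. 2 * sqrt (pulls s i t)))"
  proof (intro mult_left_mono add_mono sum_mono order_refl sum_first_pull_le L \<open>wmax \<ge> 0\<close>)
    fix i
    have "(\<Sum>k<t. ?e i k) \<le> 2 * sqrt (real (pulls s i t - 1))"
      by (rule sum_inverse_sqrt_pulls_le)
    also have "\<dots> \<le> 2 * sqrt (pulls s i t)" by simp
    finally show "(\<Sum>k<t. ?e i k) \<le> 2 * sqrt (pulls s i t)" .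
  qed
  also have "\<dots> = wmax * ((\<Sum>k<t. \<Sum>i\<in>arms N. ?a i k) + real N
      + 2 * ?L * (\<Sum>i\<in>arms N. sqrt (pulls s i t)))"
    by (simp flip: sum_distrib_left)
  also have "\<dots> \<le> wmax * ((\<Sum>k<t. \<Sum>i\<in>arms N. ?a i k) + real N
      + 2 * ?L * sqrt (real m * real N * real t))"
    using sum_sqrt_pulls_le[OF s] L \<open>wmax \<ge> 0\<close>
    by (intro mult_left_mono add_left_mono) auto
  finally show ?thesis .
qed

section \<open>Virtual queues and their drift\<close>

lemma queue_nonneg: "queue r s i t \<ge> 0"
  by (cases t) auto

lemma queue_le: "r i \<le> 1 \<Longrightarrow> queue r s i t \<le> real t"
  by (induction t) (auto simp: selected_def)

text \<open>Truncation at 0 cannot increase the square, and the untruncated increment has absolute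
  value at most 1.\<close>

lemma queue_drift:
  assumes "r i \<in> {0..1}"
  shows "(queue r s i (Suc t))\<^sup>2 - (queue r s i t)\<^sup>2
    \<le> 1 + 2 * queue r s i t * (r i - real (selected s i t))"
proof -
  define Q e where "Q = queue r s i t" and "e = r i - real (selected s i t)"
  have "\<bar>e\<bar> \<le> 1" using assms by (auto simp: e_def selected_def)
  then have "e\<^sup>2 \<le> 1" by (simp add: abs_square_le_1)
  have "(max (Q + e) 0)\<^sup>2 \<le> (Q + e)\<^sup>2" by (simp add: max_def)
  also have "\<dots> \<le> Q\<^sup>2 + 1 + 2 * Q * e"
    using \<open>e\<^sup>2 \<le> 1\<close> by (simp add: power2_sum)
  finally show ?thesis by (simp add: Q_def e_def algebra_simps)
qed

text \<open>Here \<open>c\<close> is a competing selection, \<open>d\<close> the played one and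
  \<open>u\<close> the estimates that enter the scores. Comparing scores replaces \<open>d\<close>
  by \<open>c\<close> in the queue term, at the price of an error where \<open>u\<close> differs
  from the true means.\<close>

lemma drift_plus_penalty:
  fixes c d \<mu> :: "nat \<Rightarrow> real" and s :: "nat \<Rightarrow> nat set" and t :: nat
  defines "d \<equiv> \<lambda>i. real (selected s i t)"
  assumes r: "\<And>i. i \<in> arms N \<Longrightarrow> r i \<in> {0..1}"
    and better: "(\<Sum>i\<in>arms N. c i * (queue r s i t + \<eta> * w i * u i))
      \<le> (\<Sum>i\<in>arms N. d i * (queue r s i t + \<eta> * w i * u i))"
  shows "\<eta> * (\<Sum>i\<in>arms N. w i * \<mu> i * (c i - d i))
      + ((\<Sum>i\<in>arms N. (queue r s i (Suc t))\<^sup>2) - (\<Sum>i\<in>arms N. (queue r s i t)\<^sup>2)) / 2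
    \<le> real N / 2 + (\<Sum>i\<in>arms N. queue r s i t * (r i - c i))
      + \<eta> * (\<Sum>i\<in>arms N. w i * ((c i - d i) * (\<mu> i - u i)))"
proof -
  let ?Q = "\<lambda>i. queue r s i t"
  have "(\<Sum>i\<in>arms N. (queue r s i (Suc t))\<^sup>2) - (\<Sum>i\<in>arms N. (?Q i)\<^sup>2)
      \<le> (\<Sum>i\<in>arms N. 1 + 2 * ?Q i * (r i - d i))"
    unfolding sum_subtractf[symmetric] d_def by (intro sum_mono queue_drift r)
  also have "\<dots> = real N + 2 * (\<Sum>i\<in>arms N. ?Q i * (r i - d i))"
    by (simp add: sum.distrib sum_distrib_left mult.assoc)
  finally have "((\<Sum>i\<in>arms N. (queue r s i (Suc t))\<^sup>2) - (\<Sum>i\<in>arms N. (?Q i)\<^sup>2)) / 2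
      \<le> real N / 2 + (\<Sum>i\<in>arms N. ?Q i * (r i - d i))" by simp
  \<comment> \<open>An exact identity whose last bracket is the score difference, nonpositive by
    \<open>better\<close>.\<close>
  moreover have "(\<Sum>i\<in>arms N. ?Q i * (r i - d i)) + \<eta> * (\<Sum>i\<in>arms N. w i * \<mu> i * (c i - d i))
      = (\<Sum>i\<in>arms N. ?Q i * (r i - c i)) + \<eta> * (\<Sum>i\<in>arms N. w i * ((c i - d i) * (\<mu> i - u i)))
        + ((\<Sum>i\<in>arms N. c i * (?Q i + \<eta> * w i * u i)) - (\<Sum>i\<in>arms N. d i * (?Q i + \<eta> * w i * u i)))"
    unfolding sum_distrib_left sum.distrib[symmetric] sum_subtractf[symmetric]
    by (intro sum.cong) (auto simp: algebra_simps)
  ultimately show ?thesis using better by linarith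
qed

section \<open>Points of the linear program as mixtures of super arms\<close>

definition marginal ::
  "nat \<Rightarrow> (nat set \<Rightarrow> nat set \<Rightarrow> real) \<Rightarrow> nat set \<Rightarrow> nat \<Rightarrow> real" where
  "marginal m q Z i = (\<Sum>B | B \<in> super_arms m Z \<and> i \<in> B. q Z B)"

lemma finite_super_arms: "finite Z \<Longrightarrow> finite (super_arms m Z)"
  by (rule finite_subset[of _ "Pow Z"]) (auto simp: super_arms_def)

lemma finite_subset_arms: "Z \<subseteq> arms N \<Longrightarrow> finite Z"
  by (rule finite_subset) auto

text \<open>Exchanging the sums collects the weight of each arm; for a feasible \<open>q\<close>
  this weight is the probability of playing the arm when \<open>Z\<close> is available.\<close>

lemma sum_mixture:
  assumes "Z \<subseteq> arms N"
  shows "(\<Sum>B\<in>super_arms m Z. q Z B * (\<Sum>i\<in>B. y i)) = (\<Sum>i\<in>arms N. marginal m q Z i * y i)"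
proof -
  note fin = finite_super_arms[OF finite_subset_arms[OF assms], of m]
  have "(\<Sum>i\<in>B. y i) = (\<Sum>i\<in>arms N. if i \<in> B then y i else 0)" if "B \<in> super_arms m Z" for B
  proof -
    have "arms N \<inter> B = B" using that assms by (auto simp: super_arms_def)
    then show ?thesis by (simp flip: sum.inter_restrict)
  qed
  then have "(\<Sum>B\<in>super_arms m Z. q Z B * (\<Sum>i\<in>B. y i))
      = (\<Sum>B\<in>super_arms m Z. \<Sum>i\<in>arms N. if i \<in> B then q Z B * y i else 0)"
    by (auto intro!: sum.cong simp: sum_distrib_left)
  also have "\<dots> = (\<Sum>i\<in>arms N. \<Sum>B\<in>super_arms m Z. if i \<in> B then q Z B * y i else 0)"
    by (rule sum.swap)
  also have "\<dots> = (\<Sum>i\<in>arms N. marginal m q Z i * y i)"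
  proof (rule sum.cong)
    fix i
    have "super_arms m Z \<inter> {B. i \<in> B} = {B. B \<in> super_arms m Z \<and> i \<in> B}" by auto
    then show "(\<Sum>B\<in>super_arms m Z. if i \<in> B then q Z B * y i else 0) = marginal m q Z i * y i"
      using fin by (simp add: marginal_def sum_distrib_right sum.If_cases)
  qed simp
  finally show ?thesis .
qed

lemma marginal_range:
  assumes "q \<in> lp_feasible N m PA r" "Z \<subseteq> arms N"
  shows "marginal m q Z i \<in> {0..1}"
proof -
  note fin = finite_super_arms[OF finite_subset_arms[OF assms(2)], of m]
  have nonneg: "q Z B \<ge> 0" if "B \<in> super_arms m Z" for B
    using assms that by (auto simp: lp_feasible_def)
  have "marginal m q Z i \<le> (\<Sum>B\<in>super_arms m Z. q Z B)"
    unfolding marginal_def using fin nonneg by (intro sum_mono2) auto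
  also have "\<dots> = 1" using assms by (auto simp: lp_feasible_def)
  finally show ?thesis
    using nonneg by (auto simp: marginal_def intro: sum_nonneg)
qed

text \<open>The weights of a feasible point at \<open>Z\<close> are nonnegative with sum 1, and an
  average never exceeds the maximum.\<close>

lemma mixture_le_argmax:
  assumes "q \<in> lp_feasible N m PA r" "Z \<subseteq> arms N"
    and max: "is_arg_max (\<lambda>B. \<Sum>i\<in>B. y i) (\<lambda>B. B \<in> super_arms m Z) B"
  shows "(\<Sum>i\<in>arms N. marginal m q Z i * y i) \<le> (\<Sum>i\<in>B. y i)"
proof -
  have "(\<Sum>i\<in>arms N. marginal m q Z i * y i) = (\<Sum>B\<in>super_arms m Z. q Z B * (\<Sum>i\<in>B. y i))"
    by (rule sum_mixture[symmetric]) fact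
  also have "\<dots> \<le> (\<Sum>B'\<in>super_arms m Z. q Z B' * (\<Sum>i\<in>B. y i))"
    using assms by (intro sum_mono mult_left_mono)
      (auto simp: is_arg_max_linorder lp_feasible_def)
  also have "\<dots> = (\<Sum>i\<in>B. y i)"
    using assms by (auto simp: lp_feasible_def simp flip: sum_distrib_right)
  finally show ?thesis .
qed

subsection \<open>Concentration of the empirical means\<close>

text \<open>The interval has length 1 with free left end, so that rewards and negated rewards are
  both covered.\<close>

lemma (in prob_space) Hoeffding_lemma_expectation:
  fixes f :: "'a \<Rightarrow> real"
  assumes f: "f \<in> borel_measurable M" "\<And>\<omega>. \<omega> \<in> space M \<Longrightarrow> f \<omega> \<in> {a..a + 1}" and "l > 0"
  shows "expectation (\<lambda>\<omega>. exp (l * (f \<omega> - expectation f))) \<le> exp (l\<^sup>2 / 8)"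
proof -
  interpret interval_bounded_random_variable M f a "a + 1"
    by unfold_locales (use f in auto)
  have "(\<integral>\<^sup>+\<omega>. ennreal (exp (l * (f \<omega> - expectation f))) \<partial>M) \<le> ennreal (exp (l\<^sup>2 / 8))"
    using Hoeffdings_lemma_nn_integral[OF \<open>l > 0\<close>] by simp
  then show ?thesis
    using f by (subst integral_eq_nn_integral) (auto intro: enn2real_leI)
qed

lemma sum_inverse_squares_le: "(\<Sum>k<T. 2 / (real k)\<^sup>2) \<le> pi\<^sup>2 / 3"
proof -
  have sums: "(\<lambda>k. 1 / (real k + 1)\<^sup>2) sums (pi\<^sup>2 / 6)"
    using inverse_squares_sums by (simp add: add.commute)
  \<comment> \<open>The extra term prepares the index shift; the term for \<open>k = 0\<close>
    vanishes, since division by zero yields 0.\<close>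
  have "(\<Sum>k<T. 2 / (real k)\<^sup>2) \<le> (\<Sum>k<Suc T. 2 / (real k)\<^sup>2)"
    by simp
  also have "\<dots> = 2 * (\<Sum>k<T. 1 / (real k + 1)\<^sup>2)"
    unfolding sum.lessThan_Suc_shift by (simp add: sum_distrib_left add.commute)
  also have "(\<Sum>k<T. 1 / (real k + 1)\<^sup>2) \<le> (\<Sum>k. 1 / (real k + 1)\<^sup>2)"
    by (intro sum_le_suminf sums_summable[OF sums]) auto
  also have "\<dots> = pi\<^sup>2 / 6"
    using sums by (rule sums_unique[symmetric])
  finally show ?thesis by simp
qed

context bandit_policy
begin

abbreviation sel :: "nat \<Rightarrow> nat \<Rightarrow> 'a \<Rightarrow> real" where
  "sel i k \<omega> \<equiv> real (selected (\<lambda>k. S k \<omega>) i k)"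

abbreviation Xs :: "'a \<Rightarrow> nat \<Rightarrow> nat \<Rightarrow> real" where
  "Xs \<omega> \<equiv> \<lambda>i k. X i k \<omega>"

lemma sel_info: "sel i k \<in> borel_measurable (info k)"
proof -
  have "sel i k \<omega> = indicator {\<omega> \<in> space M. i \<in> S k \<omega>} \<omega>" if "\<omega> \<in> space (info k)" for \<omega>
    using that by (simp add: selected_def)
  then show ?thesis
    by (subst measurable_cong) (use in_S_measurable[OF S_info space_info] in auto)
qed

lemma sel_past: "k < t \<Longrightarrow> sel i k \<in> borel_measurable (past t)"
  using sel_info by (rule measurable_info_past)

lemma sel_measurable [measurable]: "sel i k \<in> borel_measurable M"
  using sel_info by (rule measurable_info_M)

lemma measurable_past_M: "f \<in> past t \<rightarrow>\<^sub>M L \<Longrightarrow> f \<in> M \<rightarrow>\<^sub>M L"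
  by (rule measurable_info_M[OF measurable_past_info])

lemma pulls_past: "(\<lambda>\<omega>. real (pulls (\<lambda>k. S k \<omega>) i t)) \<in> borel_measurable (past t)"
  unfolding pulls_def of_nat_sum by (intro borel_measurable_sum sel_past) simp

lemma emp_mean_past:
  assumes "i \<in> arms N"
  shows "(\<lambda>\<omega>. emp_mean (\<lambda>k. S k \<omega>) (Xs \<omega>) i t) \<in> borel_measurable (past t)"
  unfolding emp_mean_def
  by (intro borel_measurable_times borel_measurable_divide borel_measurable_const pulls_past
      borel_measurable_sum sel_past X_past assms) auto

lemma queue_past: "(\<lambda>\<omega>. queue r (\<lambda>k. S k \<omega>) i t) \<in> borel_measurable (past t)"
proof (induction t)
  case (Suc t)
  have [measurable]: "(\<lambda>\<omega>. queue r (\<lambda>k. S k \<omega>) i t) \<in> borel_measurable (past (Suc t))"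
    using Suc by (rule measurable_past_mono) simp
  have [measurable]: "sel i t \<in> borel_measurable (past (Suc t))"
    by (rule sel_past) simp
  show ?case by simp
qed simp

lemma deviates_measurable:
  assumes "i \<in> arms N"
  shows "{\<omega> \<in> space M. deviates (\<lambda>k. S k \<omega>) (Xs \<omega>) \<mu> i t} \<in> events"
proof -
  note [measurable] = pulls_past[THEN measurable_past_M] emp_mean_past[OF assms, THEN measurable_past_M]
  have "{\<omega> \<in> space M. real (pulls (\<lambda>k. S k \<omega>) i t) > 0 \<and>
      \<bar>emp_mean (\<lambda>k. S k \<omega>) (Xs \<omega>) i t - \<mu>\<bar>
        > sqrt (3 * ln (real t) / (2 * real (pulls (\<lambda>k. S k \<omega>) i t)))} \<in> events"
    by measurable
  then show ?thesis by (simp add: deviates_def radius_def)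
qed

lemma integrable_X: "i \<in> arms N \<Longrightarrow> integrable M (X i k)"
  by (rule integrable_const_bound[where B = 1]) (use reward_range in \<open>auto intro!: AE_I2\<close>)

lemma mu_range:
  assumes "i \<in> arms N"
  shows "mu i \<in> {0..1}"
proof -
  have "expectation (X i 0) \<ge> 0"
    using reward_range[OF assms] by (intro integral_nonneg_AE AE_I2) auto
  moreover have "expectation (X i 0) \<le> expectation (\<lambda>_. 1)"
    using reward_range[OF assms] integrable_X[OF assms] by (intro integral_mono) auto
  ultimately show ?thesis
    using reward_mean[OF assms, of 0] by (simp add: prob_space)
qed

lemma expectation_info_reward:
  fixes f :: "'a \<Rightarrow> real" and g :: "real \<Rightarrow> real"
  assumes "i \<in> arms N" "f \<in> borel_measurable (info t)" "integrable M f"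
    "g \<in> borel_measurable borel" "integrable M (\<lambda>\<omega>. g (X i t \<omega>))"
  shows "integrable M (\<lambda>\<omega>. f \<omega> * g (X i t \<omega>))"
    and "expectation (\<lambda>\<omega>. f \<omega> * g (X i t \<omega>)) = expectation f * expectation (\<lambda>\<omega>. g (X i t \<omega>))"
proof -
  have "(\<lambda>\<omega>. g (X i t \<omega>)) \<in> borel_measurable (vimage_algebra (space M) (rewards N X t) (reward_space N))"
    using X_rewards_algebra[OF assms(1)] assms(4) by (rule measurable_compose)
  note indep = expectation_indep_mult[OF indep_info_rewards space_info space_vimage_algebra
      assms(2) this assms(3,5)]
  show "integrable M (\<lambda>\<omega>. f \<omega> * g (X i t \<omega>))"
    "expectation (\<lambda>\<omega>. f \<omega> * g (X i t \<omega>)) = expectation f * expectation (\<lambda>\<omega>. g (X i t \<omega>))"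
    by (rule indep)+
qed

text \<open>The number of pulls is random, so Hoeffding's inequality does not apply directly to the
  empirical mean; this exponential supermartingale replaces it.\<close>

lemma exp_supermartingale:
  fixes g l :: real
  assumes i: "i \<in> arms N" and l: "l > 0" and g: "g \<in> {-1, 1}"
  defines "W \<equiv> \<lambda>t \<omega>. exp (\<Sum>k<t. sel i k \<omega> * (l * (g * (X i k \<omega> - mu i)) - l\<^sup>2 / 8))"
  shows "integrable M (W t) \<and> expectation (W t) \<le> 1"
proof -
  define D where "D k \<omega> = l * (g * (X i k \<omega> - mu i)) - l\<^sup>2 / 8" for k \<omega>
  have D_le: "D k \<omega> \<le> l" if "\<omega> \<in> space M" for k \<omega>
  proof -
    have "g * (X i k \<omega> - mu i) \<le> 1"
      using reward_range[OF i that, of k] mu_range[OF i] g by auto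
    then have "l * (g * (X i k \<omega> - mu i)) \<le> l * 1"
      using l by (intro mult_left_mono) auto
    moreover have "l\<^sup>2 / 8 \<ge> 0" by simp
    ultimately show ?thesis unfolding D_def by linarith
  qed
  have D_past: "D k \<in> borel_measurable (past t)" if "k < t" for k t
    unfolding D_def[abs_def] using X_past[OF i that] by measurable
  have D_M [measurable]: "D k \<in> borel_measurable M" for k
    using D_past[of k "Suc k"] measurable_past_M by blast
  have W_past: "W t \<in> borel_measurable (past t)" for t
  proof -
    have "(\<lambda>\<omega>. \<Sum>k<t. sel i k \<omega> * D k \<omega>) \<in> borel_measurable (past t)"
      by (intro borel_measurable_sum borel_measurable_times sel_past D_past) auto
    from measurable_compose[OF this borel_measurable_exp] show ?thesis
      by (simp add: W_def D_def)
  qed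
  have [measurable]: "W t \<in> borel_measurable M" for t
    using W_past by (rule measurable_past_M)
  \<comment> \<open>This crude deterministic bound serves only to make \<open>W t\<close>
    integrable.\<close>
  have W_bound: "W t \<omega> \<le> exp (real t * l)" if "\<omega> \<in> space M" for t \<omega>
  proof -
    have "(\<Sum>k<t. sel i k \<omega> * D k \<omega>) \<le> (\<Sum>k<t. l)"
    proof (intro sum_mono)
      fix k show "sel i k \<omega> * D k \<omega> \<le> l"
        using D_le[OF that, of k] l by (simp add: selected_def)
    qed
    then show ?thesis by (simp add: W_def D_def)
  qed
  have W_int: "integrable M (W t)" for t
  proof (rule integrable_const_bound[where B = "exp (real t * l)"])
    show "AE \<omega> in M. norm (W t \<omega>) \<le> exp (real t * l)"
      using W_bound by (intro AE_I2) (simp add: W_def)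
  qed simp
  have E_int: "integrable M (\<lambda>\<omega>. exp (D k \<omega>))" for k
    by (rule integrable_const_bound[where B = "exp l"])
      (use D_le in \<open>auto intro!: AE_I2\<close>)
  have E_le: "expectation (\<lambda>\<omega>. exp (D k \<omega>)) \<le> 1" for k
  proof -
    \<comment> \<open>Depending on the sign \<open>g\<close>, the signed reward lies in [0, 1] or in
      [-1, 0]. The compensator \<open>l\<^sup>2 / 8\<close> in \<open>D\<close> exactly cancels
      Hoeffding's bound.\<close>
    have "expectation (\<lambda>\<omega>. exp (l * (g * X i k \<omega> - expectation (\<lambda>\<omega>. g * X i k \<omega>)))) \<le> exp (l\<^sup>2 / 8)"
      by (rule Hoeffding_lemma_expectation[where a = "if g = 1 then 0 else - 1"])
        (use i l g reward_range[OF i] in auto)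
    then have "expectation (\<lambda>\<omega>. exp (l * (g * (X i k \<omega> - mu i)))) \<le> exp (l\<^sup>2 / 8)"
      by (simp add: reward_mean[OF i] right_diff_distrib)
    then show ?thesis
      by (simp add: D_def exp_diff)
  qed
  have "expectation (W t) \<le> 1"
  proof (induction t)
    case 0
    then show ?case by (simp add: W_def prob_space)
  next
    case (Suc t)
    \<comment> \<open>A round without a play of \<open>i\<close> leaves \<open>W\<close> unchanged;
      a play multiplies it by \<open>exp (D t \<omega>)\<close>. Whether \<open>i\<close> is played
      is known in \<open>info t\<close>, so that factor is independent of what precedes it.\<close>
    have split: "W (Suc t) \<omega> = W t \<omega> * (1 - sel i t \<omega>) + (W t \<omega> * sel i t \<omega>) * exp (D t \<omega>)" for \<omega>
      by (simp add: W_def D_def selected_def exp_add)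
    have Wd_int: "integrable M (\<lambda>\<omega>. W t \<omega> * sel i t \<omega>)"
    proof (rule Bochner_Integration.integrable_bound[OF W_int[of t]])
      show "AE \<omega> in M. norm (W t \<omega> * sel i t \<omega>) \<le> norm (W t \<omega>)"
        by (simp add: selected_def)
    qed simp
    have Wd_info: "(\<lambda>\<omega>. W t \<omega> * sel i t \<omega>) \<in> borel_measurable (info t)"
      using W_past[THEN measurable_past_info] sel_info by measurable
    have prod: "integrable M (\<lambda>\<omega>. (W t \<omega> * sel i t \<omega>) * exp (D t \<omega>))"
      "expectation (\<lambda>\<omega>. (W t \<omega> * sel i t \<omega>) * exp (D t \<omega>))
        = expectation (\<lambda>\<omega>. W t \<omega> * sel i t \<omega>) * expectation (\<lambda>\<omega>. exp (D t \<omega>))"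
      using expectation_info_reward[OF i Wd_info Wd_int,
          of "\<lambda>x. exp (l * (g * (x - mu i)) - l\<^sup>2 / 8)"] E_int[of t]
      by (auto simp: D_def)
    have "expectation (W (Suc t)) = expectation (\<lambda>\<omega>. (W t \<omega> - W t \<omega> * sel i t \<omega>)
        + (W t \<omega> * sel i t \<omega>) * exp (D t \<omega>))"
      by (rule Bochner_Integration.integral_cong) (auto simp: split algebra_simps)
    also have "\<dots> = expectation (W t) - expectation (\<lambda>\<omega>. W t \<omega> * sel i t \<omega>)
        + expectation (\<lambda>\<omega>. W t \<omega> * sel i t \<omega>) * expectation (\<lambda>\<omega>. exp (D t \<omega>))"
      using W_int Wd_int prod by simp
    also have "\<dots> \<le> expectation (W t)"
    proof -
      have "expectation (\<lambda>\<omega>. W t \<omega> * sel i t \<omega>) \<ge> 0"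
        by (intro integral_nonneg_AE AE_I2) (simp add: W_def)
      then have "expectation (\<lambda>\<omega>. W t \<omega> * sel i t \<omega>) * expectation (\<lambda>\<omega>. exp (D t \<omega>))
          \<le> expectation (\<lambda>\<omega>. W t \<omega> * sel i t \<omega>) * 1"
        using E_le by (intro mult_left_mono)
      then show ?thesis by simp
    qed
    finally show ?case using Suc by simp
  qed
  with W_int show ?thesis by blast
qed

text \<open>Fixing the number of pulls to \<open>n\<close> makes the total compensator
  deterministic, so Markov's inequality for the supermartingale yields a Chernoff bound.\<close>

lemma prob_one_sided_deviation:
  assumes i: "i \<in> arms N" and g: "g \<in> {-1, 1}" and t: "t \<ge> 1" and n: "n \<ge> 1"
  defines "F \<equiv> {\<omega> \<in> space M. pulls (\<lambda>k. S k \<omega>) i t = n \<and>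
      g * (\<Sum>k<t. sel i k \<omega> * (X i k \<omega> - mu i)) > real n * sqrt (3 * ln (real t) / (2 * real n))}"
  shows "F \<in> events" and "prob F \<le> 1 / real t ^ 3"
proof -
  define e where "e = sqrt (3 * ln (real t) / (2 * real n))"
  note [measurable] = pulls_past[THEN measurable_past_M] X_measurable[OF i]
  have "{\<omega> \<in> space M. real (pulls (\<lambda>k. S k \<omega>) i t) = real n \<and>
      g * (\<Sum>k<t. sel i k \<omega> * (X i k \<omega> - mu i)) > real n * e} \<in> events"
    by measurable
  then show F: "F \<in> events" by (simp add: F_def e_def)
  show "prob F \<le> 1 / real t ^ 3"
  \<comment> \<open>For \<open>t = 1\<close> the bound is 1 and trivial; for larger \<open>t\<close>
    the logarithm, hence \<open>e\<close> and \<open>l\<close>, is positive.\<close>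
  proof (cases "t = 1")
    case False
    with t have t: "t > 1" by simp
    \<comment> \<open>This \<open>l\<close> maximizes the exponent
      \<open>l * (n * e) - n * l\<^sup>2 / 8\<close>, with value
      \<open>2 * n * e\<^sup>2 = 3 * ln t\<close>; hence the threshold \<open>t ^ 3\<close>.\<close>
    define l where "l = 4 * e"
    have e2: "real n * e\<^sup>2 = 3 * ln (real t) / 2" and "e > 0"
      using t n by (auto simp: e_def)
    then have l: "l > 0" by (simp add: l_def)
    define W where "W \<omega> = exp (\<Sum>k<t. sel i k \<omega> * (l * (g * (X i k \<omega> - mu i)) - l\<^sup>2 / 8))" for \<omega>
    have W: "integrable M W" "expectation W \<le> 1"
      using exp_supermartingale[OF i l g, of t] unfolding W_def by auto
    have W_nonneg: "W \<omega> \<ge> 0" for \<omega>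
      by (simp add: W_def)
    have "F \<subseteq> {\<omega> \<in> space M. W \<omega> \<ge> real t ^ 3}"
    proof
      fix \<omega> assume "\<omega> \<in> F"
      then have \<omega>: "\<omega> \<in> space M" "pulls (\<lambda>k. S k \<omega>) i t = n"
        "g * (\<Sum>k<t. sel i k \<omega> * (X i k \<omega> - mu i)) > real n * e"
        by (auto simp: F_def e_def)
      have "real n = (\<Sum>k<t. sel i k \<omega>)"
        by (simp add: \<omega>(2)[symmetric] pulls_def)
      then have "(\<Sum>k<t. sel i k \<omega> * (l * (g * (X i k \<omega> - mu i)) - l\<^sup>2 / 8))
          = l * (g * (\<Sum>k<t. sel i k \<omega> * (X i k \<omega> - mu i))) - real n * l\<^sup>2 / 8"
        by (simp add: sum_distrib_left sum_distrib_right sum_divide_distrib right_diff_distrib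
            left_diff_distrib sum_subtractf mult_ac)
      moreover have "l * (g * (\<Sum>k<t. sel i k \<omega> * (X i k \<omega> - mu i))) \<ge> l * (real n * e)"
        using \<omega>(3) l by (intro mult_left_mono) auto
      moreover have "l * (real n * e) - real n * l\<^sup>2 / 8 = 2 * (real n * e\<^sup>2)"
        by (simp add: l_def power2_eq_square)
      ultimately have "W \<omega> \<ge> exp (3 * ln (real t))"
        by (simp add: W_def e2)
      moreover have "exp (3 * ln (real t)) = real t ^ 3"
        using t exp_of_nat_mult[of 3 "ln (real t)"] by simp
      ultimately show "\<omega> \<in> {\<omega> \<in> space M. W \<omega> \<ge> real t ^ 3}" using \<omega> by simp
    qed
    then have "prob F \<le> prob {\<omega> \<in> space M. W \<omega> \<ge> real t ^ 3}"
      using W(1) by (intro finite_measure_mono) auto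
    also have "\<dots> \<le> expectation W / real t ^ 3"
      using W(1) t
      by (intro integral_Markov_inequality_measure[where A = "{}"]) (simp_all add: W_nonneg)
    also have "\<dots> \<le> 1 / real t ^ 3"
      using W(2) by (intro divide_right_mono) auto
    finally show ?thesis .
  qed simp
qed

text \<open>Union bound over the \<open>t\<close> possible numbers of pulls and the two signs:
  \<open>2 * t\<close> events, each of probability at most \<open>1 / t ^ 3\<close>.\<close>

lemma prob_deviates:
  assumes i: "i \<in> arms N"
  shows "prob {\<omega> \<in> space M. deviates (\<lambda>k. S k \<omega>) (Xs \<omega>) (mu i) i t} \<le> 2 / (real t)\<^sup>2"
\<comment> \<open>In round 0 there are no pulls, so the event is empty, matching the value 0 of
  \<open>2 / 0\<close>.\<close>
proof (cases "t = 0")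
  case True
  then show ?thesis by (simp add: deviates_def)
next
  case False
  then have t: "t \<ge> 1" by simp
  define F where "F = (\<lambda>(n, g). {\<omega> \<in> space M. pulls (\<lambda>k. S k \<omega>) i t = n \<and>
      g * (\<Sum>k<t. sel i k \<omega> * (X i k \<omega> - mu i)) > real n * sqrt (3 * ln (real t) / (2 * real n))})"
  let ?I = "{1..t} \<times> {-1, 1::real}"
  have F: "F p \<in> events" "prob (F p) \<le> 1 / real t ^ 3" if "p \<in> ?I" for p
  proof -
    obtain n g where p: "p = (n, g)" by (cases p)
    with that have "g \<in> {-1, 1}" "n \<ge> 1" by auto
    from prob_one_sided_deviation[OF i this(1) t this(2)]
    show "F p \<in> events" "prob (F p) \<le> 1 / real t ^ 3"
      unfolding p F_def prod.case .
  qed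
  have "{\<omega> \<in> space M. deviates (\<lambda>k. S k \<omega>) (Xs \<omega>) (mu i) i t} \<subseteq> (\<Union>p\<in>?I. F p)"
  proof
    fix \<omega> assume "\<omega> \<in> {\<omega> \<in> space M. deviates (\<lambda>k. S k \<omega>) (Xs \<omega>) (mu i) i t}"
    then have \<omega>: "\<omega> \<in> space M" and dev: "deviates (\<lambda>k. S k \<omega>) (Xs \<omega>) (mu i) i t" by auto
    define n where "n = pulls (\<lambda>k. S k \<omega>) i t"
    define Y where "Y = (\<Sum>k<t. sel i k \<omega> * (X i k \<omega> - mu i))"
    have n: "n \<in> {1..t}"
      using dev pulls_le[of "\<lambda>k. S k \<omega>" i t] by (auto simp: n_def deviates_def)
    have "Y = (\<Sum>k<t. X i k \<omega> * sel i k \<omega>) - real n * mu i"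
      by (simp add: Y_def n_def pulls_def algebra_simps sum_subtractf sum_distrib_left)
    then have "emp_mean (\<lambda>k. S k \<omega>) (Xs \<omega>) i t - mu i = Y / real n"
      using n by (simp add: emp_mean_def n_def[symmetric] field_simps)
    then have "\<bar>Y / real n\<bar> > sqrt (3 * ln (real t) / (2 * real n))"
      using dev by (simp add: deviates_def radius_def n_def)
    then have "\<bar>Y\<bar> > real n * sqrt (3 * ln (real t) / (2 * real n))"
      using n by (simp add: field_simps)
    then obtain g where "g \<in> {-1, 1::real}" "g * Y > real n * sqrt (3 * ln (real t) / (2 * real n))"
      by (cases "Y \<ge> 0") force+
    with n \<omega> have "(n, g) \<in> ?I" "\<omega> \<in> F (n, g)"
      by (auto simp: F_def Y_def n_def)
    then show "\<omega> \<in> (\<Union>p\<in>?I. F p)" by blast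
  qed
  then have "prob {\<omega> \<in> space M. deviates (\<lambda>k. S k \<omega>) (Xs \<omega>) (mu i) i t} \<le> prob (\<Union>p\<in>?I. F p)"
    using F(1) by (intro finite_measure_mono) auto
  also have "\<dots> \<le> (\<Sum>p\<in>?I. prob (F p))"
    using F(1) by (intro measure_UNION_le) auto
  also have "\<dots> \<le> (\<Sum>p\<in>?I. 1 / real t ^ 3)"
    using F(2) by (intro sum_mono) auto
  also have "\<dots> = 2 / (real t)\<^sup>2"
    using t by (simp add: card_cartesian_product power2_eq_square power3_eq_cube)
  finally show ?thesis .
qed

subsection \<open>Expected regret\<close>

lemma reward_round_eq:
  assumes "\<omega> \<in> space M"
  shows "(\<Sum>i\<in>S t \<omega>. w i * X i t \<omega>) = (\<Sum>i\<in>arms N. w i * (sel i t \<omega> * X i t \<omega>))"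
proof -
  have "S t \<omega> \<subseteq> arms N" using S_subset A_subset assms by blast
  then show ?thesis
    by (intro sum.mono_neutral_cong_left) (auto simp: selected_def)
qed

lemma integrable_sel: "integrable M (sel i t)"
proof (rule integrable_const_bound[where B = 1])
  show "AE \<omega> in M. norm (sel i t \<omega>) \<le> 1"
    by (simp add: selected_def)
qed simp

text \<open>The selection is determined by \<open>info t\<close>, which is independent of the
  rewards of round \<open>t\<close>; each observed reward can thus be replaced by its mean.\<close>

lemma expectation_round_reward:
  shows "integrable M (\<lambda>\<omega>. \<Sum>i\<in>S t \<omega>. w i * X i t \<omega>)"
    and "expectation (\<lambda>\<omega>. \<Sum>i\<in>S t \<omega>. w i * X i t \<omega>)
      = (\<Sum>i\<in>arms N. w i * mu i * expectation (sel i t))"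
proof -
  have *: "integrable M (\<lambda>\<omega>. sel i t \<omega> * X i t \<omega>)"
    "expectation (\<lambda>\<omega>. sel i t \<omega> * X i t \<omega>) = mu i * expectation (sel i t)" if "i \<in> arms N" for i
    using expectation_info_reward[OF that sel_info integrable_sel, of "\<lambda>x. x"]
      integrable_X[OF that] reward_mean[OF that] by auto
  have eq: "integrable M (\<lambda>\<omega>. \<Sum>i\<in>S t \<omega>. w i * X i t \<omega>)
      \<longleftrightarrow> integrable M (\<lambda>\<omega>. \<Sum>i\<in>arms N. w i * (sel i t \<omega> * X i t \<omega>))"
    by (rule Bochner_Integration.integrable_cong) (auto simp: reward_round_eq)
  then show "integrable M (\<lambda>\<omega>. \<Sum>i\<in>S t \<omega>. w i * X i t \<omega>)"
    using * by auto
  have "expectation (\<lambda>\<omega>. \<Sum>i\<in>S t \<omega>. w i * X i t \<omega>)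
      = expectation (\<lambda>\<omega>. \<Sum>i\<in>arms N. w i * (sel i t \<omega> * X i t \<omega>))"
    by (rule Bochner_Integration.integral_cong) (auto simp: reward_round_eq)
  also have "\<dots> = (\<Sum>i\<in>arms N. w i * mu i * expectation (sel i t))"
    using * by (subst Bochner_Integration.integral_sum) (auto simp: mult.assoc)
  finally show "expectation (\<lambda>\<omega>. \<Sum>i\<in>S t \<omega>. w i * X i t \<omega>)
      = (\<Sum>i\<in>arms N. w i * mu i * expectation (sel i t))" .
qed

lemma expectation_availability:
  fixes g :: "nat set \<Rightarrow> real"
  shows "integrable M (\<lambda>\<omega>. g (A t \<omega>))"
    and "expectation (\<lambda>\<omega>. g (A t \<omega>)) = (\<Sum>Z\<in>Pow (arms N). PA Z * g Z)"
proof -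
  let ?F = "\<lambda>Z. {\<omega> \<in> space M. A t \<omega> = Z}"
  have F: "?F Z \<in> events" if "Z \<in> Pow (arms N)" for Z
  proof -
    have "A t -` {Z} \<inter> space M \<in> events"
      using that by (intro measurable_sets[OF A_measurable]) (simp add: set_space_def)
    also have "A t -` {Z} \<inter> space M = ?F Z" by auto
    finally show ?thesis .
  qed
  have eq: "g (A t \<omega>) = (\<Sum>Z\<in>Pow (arms N). g Z * indicator (?F Z) \<omega>)" if "\<omega> \<in> space M" for \<omega>
  proof -
    have "(\<Sum>Z\<in>Pow (arms N). g Z * indicator (?F Z) \<omega>)
        = (\<Sum>Z\<in>Pow (arms N). if A t \<omega> = Z then g Z else 0)"
      using that by (intro sum.cong) (auto simp: indicator_def)
    also have "\<dots> = g (A t \<omega>)"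
      using A_subset[OF that] by (simp add: sum.delta')
    finally show ?thesis by simp
  qed
  have int: "integrable M (\<lambda>\<omega>. g Z * indicator (?F Z) \<omega>)" if "Z \<in> Pow (arms N)" for Z
    using F[OF that] by (intro integrable_mult_right) (simp add: emeasure_eq_measure)
  have "integrable M (\<lambda>\<omega>. g (A t \<omega>))
      \<longleftrightarrow> integrable M (\<lambda>\<omega>. \<Sum>Z\<in>Pow (arms N). g Z * indicator (?F Z) \<omega>)"
    by (rule Bochner_Integration.integrable_cong) (auto simp: eq)
  moreover have "integrable M (\<lambda>\<omega>. \<Sum>Z\<in>Pow (arms N). g Z * indicator (?F Z) \<omega>)"
    using int by (rule Bochner_Integration.integrable_sum)
  ultimately show "integrable M (\<lambda>\<omega>. g (A t \<omega>))" by blast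
  have "expectation (\<lambda>\<omega>. g (A t \<omega>)) = expectation (\<lambda>\<omega>. \<Sum>Z\<in>Pow (arms N). g Z * indicator (?F Z) \<omega>)"
    by (rule Bochner_Integration.integral_cong) (auto simp: eq)
  also have "\<dots> = (\<Sum>Z\<in>Pow (arms N). expectation (\<lambda>\<omega>. g Z * indicator (?F Z) \<omega>))"
    by (rule Bochner_Integration.integral_sum) (rule int)
  also have "\<dots> = (\<Sum>Z\<in>Pow (arms N). PA Z * g Z)"
  proof (rule sum.cong)
    fix Z assume Z: "Z \<in> Pow (arms N)"
    have "expectation (\<lambda>\<omega>. g Z * indicator (?F Z) \<omega>) = g Z * prob (?F Z)"
      using F[OF Z] by (simp add: Int_absorb2 sets.sets_into_space)
    then show "expectation (\<lambda>\<omega>. g Z * indicator (?F Z) \<omega>) = PA Z * g Z"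
      using availability_distribution[of Z t] Z by simp
  qed simp
  finally show "expectation (\<lambda>\<omega>. g (A t \<omega>)) = (\<Sum>Z\<in>Pow (arms N). PA Z * g Z)" .
qed

text \<open>Used for queue lengths, which depend on the past only, against selection probabilities,
  which depend on the current availability only.\<close>

lemma expectation_past_availability:
  fixes f :: "'a \<Rightarrow> real" and g :: "nat set \<Rightarrow> real"
  assumes "f \<in> borel_measurable (past t)" "integrable M f"
  shows "integrable M (\<lambda>\<omega>. f \<omega> * g (A t \<omega>))"
    and "expectation (\<lambda>\<omega>. f \<omega> * g (A t \<omega>)) = expectation f * (\<Sum>Z\<in>Pow (arms N). PA Z * g Z)"
proof -
  have "(\<lambda>\<omega>. g (A t \<omega>)) \<in> borel_measurable (env_algebra t)"
    by (rule measurable_compose[OF A_env_algebra]) (simp add: set_space_def)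
  note indep = expectation_indep_mult[OF indep_past_env space_past space_env_algebra
      assms(1) this assms(2) expectation_availability(1)]
  show "integrable M (\<lambda>\<omega>. f \<omega> * g (A t \<omega>))"
    by (rule indep)
  show "expectation (\<lambda>\<omega>. f \<omega> * g (A t \<omega>)) = expectation f * (\<Sum>Z\<in>Pow (arms N). PA Z * g Z)"
    using indep(2) by (simp add: expectation_availability(2))
qed

text \<open>For feasible \<open>q\<close>, the probability that the stationary randomized rule
  \<open>q\<close> plays arm \<open>i\<close> in a round; the fairness constraint bounds it below by
  \<open>r i\<close>.\<close>

definition selection_rate :: "(nat set \<Rightarrow> nat set \<Rightarrow> real) \<Rightarrow> nat \<Rightarrow> real" where
  "selection_rate q i = (\<Sum>Z\<in>Pow (arms N). PA Z * marginal m q Z i)"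

lemma lp_objective_eq:
  "lp_objective N m PA w mu q = (\<Sum>i\<in>arms N. w i * mu i * selection_rate q i)"
proof -
  have "lp_objective N m PA w mu q
      = (\<Sum>Z\<in>Pow (arms N). PA Z * (\<Sum>i\<in>arms N. marginal m q Z i * (w i * mu i)))"
    unfolding lp_objective_def by (intro sum.cong) (simp_all add: sum_mixture)
  also have "\<dots> = (\<Sum>i\<in>arms N. \<Sum>Z\<in>Pow (arms N). w i * mu i * (PA Z * marginal m q Z i))"
    by (subst sum.swap) (simp add: sum_distrib_left mult_ac)
  finally show ?thesis
    by (simp add: selection_rate_def sum_distrib_left)
qed

lemma integrable_queue:
  assumes "r i \<in> {0..1}"
  shows "integrable M (\<lambda>\<omega>. queue r (\<lambda>k. S k \<omega>) i t)"
proof (rule integrable_const_bound[where B = "real t"])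
  show "AE \<omega> in M. norm (queue r (\<lambda>k. S k \<omega>) i t) \<le> real t"
    using queue_nonneg queue_le assms by (auto simp: abs_of_nonneg)
qed (rule queue_past[THEN measurable_past_M])

end

section \<open>Regret of LFG against a feasible point of the linear program\<close>

context lfg
begin

text \<open>\<open>drift_plus_penalty\<close> is summed over the rounds, with the conditional
  probabilities of \<open>q\<close> as competitor. The queue term is kept on the right, as its sign
  is controlled only in expectation.\<close>

lemma pathwise_gap_le:
  assumes q: "q \<in> lp_feasible N m PA r" and r: "\<And>i. i \<in> arms N \<Longrightarrow> r i \<in> {0..1}"
    and "\<eta> > 0" "wmax \<ge> 0" and \<omega>: "\<omega> \<in> space M"
  defines "c \<equiv> \<lambda>i k. marginal m q (A k \<omega>) i" and "s \<equiv> \<lambda>k. S k \<omega>"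
  shows "\<eta> * (\<Sum>k<T. \<Sum>i\<in>arms N. w i * mu i * (c i k - real (selected s i k)))
    \<le> real T * (real N / 2) + (\<Sum>k<T. \<Sum>i\<in>arms N. queue r s i k * (r i - c i k))
      + \<eta> * (wmax * ((\<Sum>k<T. \<Sum>i\<in>arms N. of_bool (deviates s (Xs \<omega>) (mu i) i k)) + real N
        + 2 * sqrt (6 * ln (real T)) * sqrt (real m * real N * real T)))"
proof -
  let ?u = "\<lambda>k i. ucb s (Xs \<omega>) i k"
  define L where "L k = (\<Sum>i\<in>arms N. (queue r s i k)\<^sup>2) / 2" for k
  have step: "\<eta> * (\<Sum>i\<in>arms N. w i * mu i * (c i k - real (selected s i k))) + (L (Suc k) - L k)
    \<le> real N / 2 + (\<Sum>i\<in>arms N. queue r s i k * (r i - c i k))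
      + \<eta> * (\<Sum>i\<in>arms N. w i * ((c i k - real (selected s i k)) * (mu i - ?u k i)))" for k
  proof -
    let ?y = "\<lambda>i. queue r s i k + \<eta> * w i * ?u k i"
    \<comment> \<open>This is where the rule of LFG enters: the played super arm maximizes the
      score, so it beats the mixture \<open>q\<close>.\<close>
    have "(\<Sum>i\<in>arms N. c i k * ?y i) \<le> (\<Sum>i\<in>s k. ?y i)"
      unfolding c_def
      using mixture_le_argmax[OF q A_subset[OF \<omega>]] plays_argmax[OF \<omega>, of k]
      unfolding lfg_score_def[abs_def] s_def by blast
    also have "(\<Sum>i\<in>s k. ?y i) = (\<Sum>i\<in>arms N. real (selected s i k) * ?y i)"
      using S_subset[OF \<omega>, of k] A_subset[OF \<omega>, of k]
      by (intro sum.mono_neutral_cong_left) (auto simp: selected_def s_def)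
    finally have "(\<Sum>i\<in>arms N. c i k * ?y i) \<le> (\<Sum>i\<in>arms N. real (selected s i k) * ?y i)" .
    from drift_plus_penalty[OF r this, of mu]
    show ?thesis by (simp add: L_def diff_divide_distrib)
  qed
  have "\<eta> * (\<Sum>k<T. \<Sum>i\<in>arms N. w i * mu i * (c i k - real (selected s i k)))
      + (\<Sum>k<T. L (Suc k) - L k)
    \<le> (\<Sum>k<T. real N / 2 + (\<Sum>i\<in>arms N. queue r s i k * (r i - c i k))
      + \<eta> * (\<Sum>i\<in>arms N. w i * ((c i k - real (selected s i k)) * (mu i - ?u k i))))"
    unfolding sum_distrib_left[of _ _ "{..<T}"] sum.distrib[symmetric] using step by (rule sum_mono)
  moreover have "(\<Sum>k<T. L (Suc k) - L k) \<ge> 0"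
  proof -
    have "(\<Sum>k<T. L (Suc k) - L k) = L T - L 0" by (rule sum_lessThan_telescope)
    moreover have "L 0 = 0" "L T \<ge> 0" by (simp_all add: L_def sum_nonneg)
    ultimately show ?thesis by linarith
  qed
  ultimately have "\<eta> * (\<Sum>k<T. \<Sum>i\<in>arms N. w i * mu i * (c i k - real (selected s i k)))
    \<le> real T * (real N / 2) + (\<Sum>k<T. \<Sum>i\<in>arms N. queue r s i k * (r i - c i k))
      + \<eta> * (\<Sum>k<T. \<Sum>i\<in>arms N. w i * ((c i k - real (selected s i k)) * (mu i - ?u k i)))"
    by (simp add: sum.distrib sum_distrib_left)
  moreover have "(\<Sum>k<T. \<Sum>i\<in>arms N. w i * ((c i k - real (selected s i k)) * (mu i - ?u k i)))
    \<le> wmax * ((\<Sum>k<T. \<Sum>i\<in>arms N. of_bool (deviates s (Xs \<omega>) (mu i) i k)) + real N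
        + 2 * sqrt (6 * ln (real T)) * sqrt (real m * real N * real T))"
  proof (rule sum_ucb_regret_le)
    show "Xs \<omega> i k \<in> {0..1}" if "i \<in> arms N" for i k using reward_range[OF that \<omega>] .
    show "c i k \<in> {0..1}" for i k
      unfolding c_def using q A_subset[OF \<omega>] by (rule marginal_range)
    show "s k \<subseteq> arms N" "card (s k) \<le> m" for k
      using S_subset[OF \<omega>, of k] A_subset[OF \<omega>, of k] card_S[OF \<omega>, of k] by (auto simp: s_def)
  qed (use mu_range weights \<open>wmax \<ge> 0\<close> in auto)
  ultimately show ?thesis
    using \<open>\<eta> > 0\<close> by (meson add_left_mono mult_left_mono order_trans less_imp_le)
qed

text \<open>In expectation the queue term becomes nonpositive, and the deviation probabilities sum
  to at most \<open>pi\<^sup>2 / 3\<close> per arm.\<close>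

lemma expected_gap_le:
  assumes q: "q \<in> lp_feasible N m PA r" and r: "\<And>i. i \<in> arms N \<Longrightarrow> r i \<in> {0..1}"
    and "\<eta> > 0" "wmax \<ge> 0"
  shows "\<eta> * (\<Sum>k<T. \<Sum>i\<in>arms N. w i * mu i * (selection_rate q i - expectation (sel i k)))
    \<le> real T * (real N / 2) + \<eta> * (wmax * (real N * (pi\<^sup>2 / 3) + real N
        + 2 * sqrt (6 * ln (real T)) * sqrt (real m * real N * real T)))"
proof -
  let ?c = "\<lambda>i k \<omega>. marginal m q (A k \<omega>) i"
  let ?Q = "\<lambda>i k \<omega>. queue r (\<lambda>k. S k \<omega>) i k"
  let ?D = "\<lambda>i k. {\<omega> \<in> space M. deviates (\<lambda>k. S k \<omega>) (Xs \<omega>) (mu i) i k}"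
  let ?K = "2 * sqrt (6 * ln (real T)) * sqrt (real m * real N * real T)"
  define lhs where "lhs \<omega> = \<eta> * (\<Sum>k<T. \<Sum>i\<in>arms N. w i * mu i * (?c i k \<omega> - sel i k \<omega>))" for \<omega>
  define rhs where "rhs \<omega> = real T * (real N / 2) + (\<Sum>k<T. \<Sum>i\<in>arms N. ?Q i k \<omega> * (r i - ?c i k \<omega>))
      + \<eta> * (wmax * ((\<Sum>k<T. \<Sum>i\<in>arms N. indicator (?D i k) \<omega>) + real N + ?K))" for \<omega>
  have le: "lhs \<omega> \<le> rhs \<omega>" if "\<omega> \<in> space M" for \<omega>
    using pathwise_gap_le[OF q r \<open>\<eta> > 0\<close> \<open>wmax \<ge> 0\<close> that, of T] that
    unfolding lhs_def rhs_def by (simp add: indicator_def)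
  have c: "integrable M (?c i k)" "expectation (?c i k) = selection_rate q i" for i k
    using expectation_availability[of "\<lambda>Z. marginal m q Z i" k] by (simp_all add: selection_rate_def)
  have lhs: "integrable M lhs"
    "expectation lhs = \<eta> * (\<Sum>k<T. \<Sum>i\<in>arms N. w i * mu i * (selection_rate q i - expectation (sel i k)))"
    unfolding lhs_def[abs_def] using c integrable_sel by simp_all
  have Q: "integrable M (?Q i k)" if "i \<in> arms N" for i k
    using r[OF that] by (rule integrable_queue)
  have Qc: "integrable M (\<lambda>\<omega>. ?Q i k \<omega> * ?c i k \<omega>)"
    "expectation (\<lambda>\<omega>. ?Q i k \<omega> * ?c i k \<omega>) = expectation (?Q i k) * selection_rate q i"
    if "i \<in> arms N" for i k
    using expectation_past_availability[OF queue_past Q[OF that], where g = "\<lambda>Z. marginal m q Z i"]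
    by (simp_all add: selection_rate_def)
  have D: "?D i k \<in> events" if "i \<in> arms N" for i k
    using that by (rule deviates_measurable)
  have D_int: "integrable M (indicator (?D i k) :: 'a \<Rightarrow> real)"
    "expectation (indicator (?D i k)) = prob (?D i k)" if "i \<in> arms N" for i k
    using D[OF that, of k] by (simp_all add: emeasure_eq_measure Int_absorb2 sets.sets_into_space)
  have rhs: "integrable M rhs"
    "expectation rhs = real T * (real N / 2)
      + (\<Sum>k<T. \<Sum>i\<in>arms N. expectation (?Q i k) * (r i - selection_rate q i))
      + \<eta> * (wmax * ((\<Sum>k<T. \<Sum>i\<in>arms N. prob (?D i k)) + real N + ?K))"
    unfolding rhs_def[abs_def] using Q Qc D_int
    by (simp_all add: right_diff_distrib prob_space)
  \<comment> \<open>By independence the expectation has factored; the queue is nonnegative and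
    feasibility gives \<open>selection_rate q i \<ge> r i\<close>.\<close>
  have "expectation (?Q i k) * (r i - selection_rate q i) \<le> 0" if "i \<in> arms N" for i k
  proof (rule mult_nonneg_nonpos)
    show "expectation (?Q i k) \<ge> 0"
      by (intro integral_nonneg_AE AE_I2 queue_nonneg)
    show "r i - selection_rate q i \<le> 0"
      using q that by (auto simp: lp_feasible_def selection_rate_def marginal_def)
  qed
  then have "(\<Sum>k<T. \<Sum>i\<in>arms N. expectation (?Q i k) * (r i - selection_rate q i)) \<le> 0"
    by (intro sum_nonpos) auto
  moreover have "(\<Sum>k<T. \<Sum>i\<in>arms N. prob (?D i k)) \<le> real N * (pi\<^sup>2 / 3)"
  proof -
    have "(\<Sum>k<T. \<Sum>i\<in>arms N. prob (?D i k)) \<le> (\<Sum>k<T. \<Sum>i\<in>arms N. 2 / (real k)\<^sup>2)"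
      by (intro sum_mono prob_deviates)
    also have "\<dots> = real N * (\<Sum>k<T. 2 / (real k)\<^sup>2)"
      by (simp add: sum_distrib_left)
    also have "\<dots> \<le> real N * (pi\<^sup>2 / 3)"
      by (intro mult_left_mono sum_inverse_squares_le) simp
    finally show ?thesis .
  qed
  then have "\<eta> * (wmax * ((\<Sum>k<T. \<Sum>i\<in>arms N. prob (?D i k)) + real N + ?K))
      \<le> \<eta> * (wmax * (real N * (pi\<^sup>2 / 3) + real N + ?K))"
    using \<open>\<eta> > 0\<close> \<open>wmax \<ge> 0\<close> by (intro mult_left_mono add_right_mono) auto
  moreover have "expectation lhs \<le> expectation rhs"
    using lhs(1) rhs(1) le by (rule integral_mono)
  ultimately show ?thesis
    unfolding lhs(2) rhs(2) by linarith
qed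

text \<open>Dividing the expected gap by \<open>\<eta> * T\<close> bounds the objective of each
  feasible \<open>q\<close> by one and the same quantity, which therefore bounds the
  supremum.\<close>

lemma regret_le:
  assumes "lp_feasible N m PA r \<noteq> {}" and r: "\<And>i. i \<in> arms N \<Longrightarrow> r i \<in> {0..1}"
    and "\<eta> > 0" "wmax \<ge> 0" "T \<ge> 1"
  shows "regret M N m PA r w mu X S T \<le> real N / (2 * \<eta>)
    + wmax * (real N * (pi\<^sup>2 / 3) + real N
        + 2 * sqrt (6 * ln (real T)) * sqrt (real m * real N * real T)) / real T"
proof -
  let ?G = "\<Sum>k<T. expectation (\<lambda>\<omega>. \<Sum>i\<in>S k \<omega>. w i * X i k \<omega>)"
  let ?B = "wmax * (real N * (pi\<^sup>2 / 3) + real N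
        + 2 * sqrt (6 * ln (real T)) * sqrt (real m * real N * real T))"
  have G: "expectation (\<lambda>\<omega>. (1 / real T) * (\<Sum>k<T. \<Sum>i\<in>S k \<omega>. w i * X i k \<omega>)) = ?G / real T"
    using expectation_round_reward(1) by simp
  have "lp_objective N m PA w mu q \<le> real N / (2 * \<eta>) + ?B / real T + ?G / real T"
    if q: "q \<in> lp_feasible N m PA r" for q
  proof -
    have "(\<Sum>k<T. \<Sum>i\<in>arms N. w i * mu i * (selection_rate q i - expectation (sel i k)))
        = real T * lp_objective N m PA w mu q - ?G"
      by (simp add: expectation_round_reward(2) lp_objective_eq right_diff_distrib sum_subtractf)
    with expected_gap_le[OF q r \<open>\<eta> > 0\<close> \<open>wmax \<ge> 0\<close>, of T]
    have "\<eta> * (real T * lp_objective N m PA w mu q - ?G) \<le> real T * (real N / 2) + \<eta> * ?B"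
      by simp
    then have "(\<eta> * (real T * lp_objective N m PA w mu q - ?G)) / (\<eta> * real T)
        \<le> (real T * (real N / 2) + \<eta> * ?B) / (\<eta> * real T)"
      using \<open>\<eta> > 0\<close> by (intro divide_right_mono) auto
    moreover have "(\<eta> * (real T * lp_objective N m PA w mu q - ?G)) / (\<eta> * real T)
        = lp_objective N m PA w mu q - ?G / real T"
      using \<open>\<eta> > 0\<close> \<open>T \<ge> 1\<close> by (simp add: diff_divide_distrib)
    moreover have "(real T * (real N / 2) + \<eta> * ?B) / (\<eta> * real T) = real N / (2 * \<eta>) + ?B / real T"
      using \<open>\<eta> > 0\<close> \<open>T \<ge> 1\<close> by (simp add: add_divide_distrib)
    ultimately show ?thesis by linarith
  qed
  then have "optimal_reward N m PA r w mu \<le> real N / (2 * \<eta>) + ?B / real T + ?G / real T"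
    unfolding optimal_reward_def using assms(1) by (intro cSUP_least)
  then show ?thesis
    unfolding regret_def G by simp
qed

end

theorem theorem2:
  fixes M :: "'a measure" and MU :: "'u measure"
    and N m T :: nat and \<eta> wmax :: real and r w mu :: "nat \<Rightarrow> real"
    and PA :: "nat set \<Rightarrow> real"
    and A S :: "nat \<Rightarrow> 'a \<Rightarrow> nat set" and X :: "nat \<Rightarrow> nat \<Rightarrow> 'a \<Rightarrow> real"
    and U :: "'a \<Rightarrow> 'u"
    and \<phi> :: "nat \<Rightarrow> 'u \<times> (nat \<Rightarrow> nat set \<times> nat set \<times> (nat \<Rightarrow> real)) \<times> nat set \<Rightarrow> nat set"
  defines "\<beta>1 \<equiv> 2 * sqrt 6 * wmax"
    and "\<beta>2 \<equiv> (1 + 5 * pi\<^sup>2 / 12) * wmax"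
  assumes "N \<ge> 1" and "m \<ge> 1" and "\<eta> > 0"
    and "\<forall>i\<in>arms N. r i \<in> {0<..<1}"
    and "lp_feasible N m PA r \<noteq> {}"
    and "lfg M N A X PA mu w wmax m MU U \<phi> S \<eta> r"
    and "T \<ge> 1"
  shows "regret M N m PA r w mu X S T
    \<le> real N / (2 * \<eta>) +
      (\<beta>1 * sqrt (real m * real N * real T * ln (real T)) + \<beta>2 * real N) / real T"
proof -
  interpret lfg M N A X PA mu w wmax m MU U \<phi> S \<eta> r by fact
  \<comment> \<open>An existing arm has positive weight at most \<open>wmax\<close>, so
    \<open>wmax\<close> is nonnegative.\<close>
  have "1 \<in> arms N" using \<open>N \<ge> 1\<close> by (simp add: arms_def)
  with weights have "wmax \<ge> 0" by fastforce
  have "regret M N m PA r w mu X S T \<le> real N / (2 * \<eta>)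
    + wmax * (real N * (pi\<^sup>2 / 3) + real N
        + 2 * sqrt (6 * ln (real T)) * sqrt (real m * real N * real T)) / real T"
    using assms \<open>wmax \<ge> 0\<close> by (intro regret_le) auto
  also have "wmax * (real N * (pi\<^sup>2 / 3) + real N
        + 2 * sqrt (6 * ln (real T)) * sqrt (real m * real N * real T))
      \<le> \<beta>1 * sqrt (real m * real N * real T * ln (real T)) + \<beta>2 * real N"
  proof -
    \<comment> \<open>The constant \<open>pi\<^sup>2 / 3\<close>, that is
      \<open>4 * pi\<^sup>2 / 12\<close>, stays below the \<open>5 * pi\<^sup>2 / 12\<close> in
      \<open>\<beta>2\<close>; the square roots combine exactly to the term with
      \<open>\<beta>1\<close>.\<close>
    have "wmax * real N * (pi\<^sup>2 / 3) \<le> wmax * real N * (5 * pi\<^sup>2 / 12)"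
      using \<open>wmax \<ge> 0\<close> by (intro mult_left_mono) auto
    then show ?thesis
      by (simp add: \<beta>1_def \<beta>2_def real_sqrt_mult algebra_simps)
  qed
  finally show ?thesis
    by (simp add: divide_right_mono)
qed

end
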